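(* Let $p\in F_I^\circ$ and assume $A_I<2$. Suppose $\{q_n\}$ and $\{q_n'\}$ are two sequences in $X^\circ$ with $q_n\to p$ and $q_n'\to p$ in the background topology. Then $$d_{g_\Pi}(q_n,q_n')\longrightarrow 0 .$$ Consequently, all sequences in $X^\circ$ converging to $p$ in the background topology determine the same point of the metric completion of $(X^\circ,d_{g_\Pi})$.
   Context: Let $X$ be a compact smooth $n$-dimensional manifold with corners (locally modelled on $[0,\infty)^k\times\mathbb R^{n-k}$, $0\le k\le n$) whose boundary hypersurfaces $H_1,\dots,H_N$ are globally embedded, and let $X^\circ=X\setminus\partial X$. For each $i$ let $\rho_i:X\to[0,\infty)$ be a smooth boundary-defining function of $H_i$: $H_i=\rho_i^{-1}(0)$, $d\rho_i\neq0$ on $H_i$, and $\rho_i>0$ on $X\setminus H_i$. Let $g_0$ be a smooth Riemannian metric on $X$ (up to the boundary), and let $\alpha_1,\dots,\alpha_N\ge 0$. The product metric on $X^\circ$ is $g_\Pi=\bigl(\prod_{i=1}^N\rho_i^{-\alpha_i}\bigr)g_0$, and $d_{g_\Pi}$ is its Riemannian distance on $X^\circ$. The background topology is the topology of $X$. For $p\in X$, $I(p)=\{i: p\in H_i\}$ is the active index set; for nonempty $I\subseteq\{1,\dots,N\}$, $F_I^\circ=\{p\in X: I(p)=I\}$ is the corresponding open face; and $A_I=\sum_{i\in I}\alpha_i$. A sequence determines a point of the metric completion when it is Cauchy; that point is its equivalence class. *)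

theory Defs
  imports "HOL-Analysis.Analysis"
begin

section \<open>Smooth maps on subsets of Euclidean space\<close>

primrec Ck_on :: "nat \<Rightarrow> 'a::real_normed_vector set \<Rightarrow> ('a \<Rightarrow> 'b::real_normed_vector) \<Rightarrow> bool"
where
  "Ck_on 0 U f \<longleftrightarrow> continuous_on U f"
| "Ck_on (Suc k) U f \<longleftrightarrow>
     (\<forall>x\<in>U. f differentiable (at x)) \<and> (\<forall>v. Ck_on k U (\<lambda>x. frechet_derivative f (at x) v))"

text \<open>
  \<^const>\<open>Ck_on\<close> is meaningful on open sets only.  On an arbitrary set (a relatively open subset
  of a corner, a closed interval) smoothness means that there are local smooth extensions.
\<close>

definition smooth_on :: "'a::real_normed_vector set \<Rightarrow> ('a \<Rightarrow> 'b::real_normed_vector) \<Rightarrow> bool" where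
  "smooth_on S f \<longleftrightarrow>
     (\<forall>x\<in>S. \<exists>U F. open U \<and> x \<in> U \<and> (\<forall>k. Ck_on k U F) \<and> (\<forall>y\<in>S \<inter> U. F y = f y))"


section \<open>Manifolds with corners\<close>

text \<open>
  The manifold is a whole type \<open>'m\<close>, its dimension is \<open>n = CARD('n)\<close>, and its smooth structure
  is given by a (not necessarily maximal) atlas.  The model of a chart is
  \<open>[0,\<infinity>)\<^sup>k \<times> \<real>\<^sup>n\<^sup>-\<^sup>k\<close>, where the \<open>k\<close> coordinates that are constrained to be nonnegative
  are those in the set \<open>chart_corner\<close>; they need not come first.
\<close>

record ('m, 'n) corner_chart =
  chart_dom :: "'m set"
  chart_corner :: "'n set"
  chart_map :: "'m \<Rightarrow> real ^ 'n"

definition corner_model :: "'n::finite set \<Rightarrow> (real ^ 'n) set" where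
  "corner_model K = {x. \<forall>i\<in>K. 0 \<le> x $ i}"

definition chart_inv :: "('m, 'n::finite) corner_chart \<Rightarrow> real ^ 'n \<Rightarrow> 'm" where
  "chart_inv c = inv_into (chart_dom c) (chart_map c)"

definition is_corner_chart :: "('m::topological_space, 'n::finite) corner_chart \<Rightarrow> bool" where
  "is_corner_chart c \<longleftrightarrow>
     open (chart_dom c) \<and>
     openin (top_of_set (corner_model (chart_corner c))) (chart_map c ` chart_dom c) \<and>
     homeomorphism (chart_dom c) (chart_map c ` chart_dom c) (chart_map c) (chart_inv c)"

definition manifold_with_corners ::
  "('m::{t2_space, second_countable_topology}, 'n::finite) corner_chart set \<Rightarrow> bool" where
  "manifold_with_corners A \<longleftrightarrow>
     (\<forall>c\<in>A. is_corner_chart c) \<and>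
     (\<Union>c\<in>A. chart_dom c) = UNIV \<and>
     (\<forall>c\<in>A. \<forall>d\<in>A.
        smooth_on (chart_map c ` (chart_dom c \<inter> chart_dom d)) (chart_map d \<circ> chart_inv c))"

definition charts_at :: "('m, 'n::finite) corner_chart set \<Rightarrow> 'm \<Rightarrow> ('m, 'n) corner_chart set" where
  "charts_at A p = {c\<in>A. p \<in> chart_dom c}"

definition vanishing_coords :: "('m, 'n::finite) corner_chart \<Rightarrow> 'm \<Rightarrow> 'n set" where
  "vanishing_coords c p = {i\<in>chart_corner c. chart_map c p $ i = 0}"

definition mfd_boundary :: "('m, 'n::finite) corner_chart set \<Rightarrow> 'm set" where
  "mfd_boundary A = {p. \<exists>c\<in>charts_at A p. vanishing_coords c p \<noteq> {}}"

definition mfd_interior :: "('m, 'n::finite) corner_chart set \<Rightarrow> 'm set" where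
  "mfd_interior A = UNIV - mfd_boundary A"

definition depth_one_stratum :: "('m, 'n::finite) corner_chart set \<Rightarrow> 'm set" where
  "depth_one_stratum A = {p. \<exists>c\<in>charts_at A p. card (vanishing_coords c p) = 1}"

definition boundary_hypersurfaces ::
  "('m::topological_space, 'n::finite) corner_chart set \<Rightarrow> 'm set set" where
  "boundary_hypersurfaces A = closure ` components (depth_one_stratum A)"

text \<open>
  Embeddedness of a boundary hypersurface: near each of its points it is the zero set of a single
  corner coordinate.  This excludes self-intersections at the corners, as for the teardrop.
\<close>

definition embedded_hypersurface ::
  "('m::topological_space, 'n::finite) corner_chart set \<Rightarrow> 'm set \<Rightarrow> bool" where
  "embedded_hypersurface A S \<longleftrightarrow>
     (\<forall>p\<in>S. \<forall>c\<in>charts_at A p. \<exists>i\<in>vanishing_coords c p. \<exists>W.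
        open W \<and> p \<in> W \<and> W \<subseteq> chart_dom c \<and> S \<inter> W = {q\<in>W. chart_map c q $ i = 0})"

definition open_face :: "(nat \<Rightarrow> 'm set) \<Rightarrow> nat \<Rightarrow> nat set \<Rightarrow> 'm set" where
  "open_face H N I = {p. {i\<in>{1..N}. p \<in> H i} = I}"


section \<open>Tangent vectors, smooth functions and Riemannian metrics\<close>

text \<open>
  A tangent vector at \<open>p\<close> is the family of its coordinate representations in the charts around
  \<open>p\<close>, related by the Jacobians of the transition maps.  The value \<open>0\<close> at all other charts makes
  the representation unique.  At a boundary point the derivative is taken within the corner, where
  it is still unique.
\<close>

type_synonym ('m, 'n) tangent_vector = "('m, 'n) corner_chart \<Rightarrow> real ^ 'n"

definition tangent_space ::
  "('m, 'n::finite) corner_chart set \<Rightarrow> 'm \<Rightarrow> ('m, 'n) tangent_vector set" where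
  "tangent_space A p =
     {v. (\<forall>c. c \<notin> charts_at A p \<longrightarrow> v c = 0) \<and>
         (\<forall>c\<in>charts_at A p. \<forall>d\<in>charts_at A p. \<exists>D.
            ((chart_map d \<circ> chart_inv c) has_derivative D)
              (at (chart_map c p) within chart_map c ` (chart_dom c \<inter> chart_dom d)) \<and>
            v d = D (v c))}"

definition smooth_function ::
  "('m, 'n::finite) corner_chart set \<Rightarrow> ('m \<Rightarrow> real) \<Rightarrow> bool" where
  "smooth_function A f \<longleftrightarrow> (\<forall>c\<in>A. smooth_on (chart_map c ` chart_dom c) (f \<circ> chart_inv c))"

definition has_differential ::
  "('m, 'n::finite) corner_chart set \<Rightarrow> ('m \<Rightarrow> real) \<Rightarrow> 'm \<Rightarrow>
     (('m, 'n) tangent_vector \<Rightarrow> real) \<Rightarrow> bool" where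
  "has_differential A f p L \<longleftrightarrow>
     (\<forall>c\<in>charts_at A p. \<exists>D.
        ((f \<circ> chart_inv c) has_derivative D) (at (chart_map c p) within chart_map c ` chart_dom c) \<and>
        (\<forall>v\<in>tangent_space A p. L v = D (v c)))"

definition boundary_defining_function ::
  "('m, 'n::finite) corner_chart set \<Rightarrow> 'm set \<Rightarrow> ('m \<Rightarrow> real) \<Rightarrow> bool" where
  "boundary_defining_function A S \<rho> \<longleftrightarrow>
     smooth_function A \<rho> \<and>
     (\<forall>p. 0 \<le> \<rho> p) \<and>
     S = {p. \<rho> p = 0} \<and>
     (\<forall>p\<in>S. \<exists>L. has_differential A \<rho> p L \<and> (\<exists>v\<in>tangent_space A p. L v \<noteq> 0))"

type_synonym ('m, 'n) metric_tensor =
  "'m \<Rightarrow> ('m, 'n) tangent_vector \<Rightarrow> ('m, 'n) tangent_vector \<Rightarrow> real"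

text \<open>
  The last clause is the local expression of the metric in a chart, with coefficient matrix \<open>G\<close>
  smooth up to the boundary; it contains the bilinearity.
\<close>

definition riemannian_metric ::
  "('m, 'n::finite) corner_chart set \<Rightarrow> ('m, 'n) metric_tensor \<Rightarrow> bool" where
  "riemannian_metric A g \<longleftrightarrow>
     (\<forall>p. \<forall>v\<in>tangent_space A p. \<forall>w\<in>tangent_space A p. g p v w = g p w v) \<and>
     (\<forall>p. \<forall>v\<in>tangent_space A p. v \<noteq> (\<lambda>_. 0) \<longrightarrow> 0 < g p v v) \<and>
     (\<forall>c\<in>A. \<exists>G :: real ^ 'n \<Rightarrow> real ^ 'n ^ 'n.
        smooth_on (chart_map c ` chart_dom c) G \<and>
        (\<forall>p\<in>chart_dom c. \<forall>v\<in>tangent_space A p. \<forall>w\<in>tangent_space A p.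
           g p v w = v c \<bullet> (G (chart_map c p) *v w c)))"

definition product_metric ::
  "(nat \<Rightarrow> 'm \<Rightarrow> real) \<Rightarrow> (nat \<Rightarrow> real) \<Rightarrow> nat \<Rightarrow> ('m, 'n::finite) metric_tensor \<Rightarrow> ('m, 'n) metric_tensor"
where
  "product_metric \<rho> \<alpha> N g p v w = (\<Prod>i=1..N. \<rho> i p powr (- \<alpha> i)) * g p v w"


section \<open>Riemannian distance on the interior\<close>

definition piecewise_smooth_curve ::
  "('m::topological_space, 'n::finite) corner_chart set \<Rightarrow> (real \<Rightarrow> 'm) \<Rightarrow> bool" where
  "piecewise_smooth_curve A \<gamma> \<longleftrightarrow>
     continuous_on {0..1} \<gamma> \<and>
     (\<exists>T. finite T \<and> {0, 1} \<subseteq> T \<and> T \<subseteq> {0..1} \<and>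
        (\<forall>a\<in>T. \<forall>b\<in>T. a < b \<and> {a<..<b} \<inter> T = {} \<longrightarrow>
           (\<forall>c\<in>A. smooth_on {s\<in>{a..b}. \<gamma> s \<in> chart_dom c} (chart_map c \<circ> \<gamma>))))"

text \<open>
  The velocity is meaningful except at the finitely many break points, which do not contribute
  to the length.
\<close>

definition velocity ::
  "('m, 'n::finite) corner_chart set \<Rightarrow> (real \<Rightarrow> 'm) \<Rightarrow> real \<Rightarrow> ('m, 'n) tangent_vector" where
  "velocity A \<gamma> t =
     (\<lambda>c. if c \<in> charts_at A (\<gamma> t)
          then vector_derivative (chart_map c \<circ> \<gamma>) (at t within {0..1}) else 0)"

definition curve_length ::
  "('m, 'n::finite) corner_chart set \<Rightarrow> ('m, 'n) metric_tensor \<Rightarrow> (real \<Rightarrow> 'm) \<Rightarrow> real" where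
  "curve_length A g \<gamma> =
     integral {0..1} (\<lambda>t. sqrt (g (\<gamma> t) (velocity A \<gamma> t) (velocity A \<gamma> t)))"

text \<open>
  The distance has values in \<^typ>\<open>ennreal\<close>: the manifold need not be connected, and the distance
  of points in different components of the interior is \<open>\<infinity>\<close>.
\<close>

definition interior_distance ::
  "('m::topological_space, 'n::finite) corner_chart set \<Rightarrow> ('m, 'n) metric_tensor \<Rightarrow>
     'm \<Rightarrow> 'm \<Rightarrow> ennreal" where
  "interior_distance A g x y =
     (INF \<gamma>\<in>{\<gamma>. piecewise_smooth_curve A \<gamma> \<and> \<gamma> ` {0..1} \<subseteq> mfd_interior A \<and> \<gamma> 0 = x \<and> \<gamma> 1 = y}.
        ennreal (curve_length A g \<gamma>))"


section \<open>Metric completion by Cauchy sequences\<close>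

definition cauchy_seqs :: "'m set \<Rightarrow> ('m \<Rightarrow> 'm \<Rightarrow> ennreal) \<Rightarrow> (nat \<Rightarrow> 'm) set" where
  "cauchy_seqs S d =
     {q. range q \<subseteq> S \<and> (\<forall>e>0. \<exists>M. \<forall>m\<ge>M. \<forall>n\<ge>M. d (q m) (q n) < e)}"

definition cauchy_equiv :: "'m set \<Rightarrow> ('m \<Rightarrow> 'm \<Rightarrow> ennreal) \<Rightarrow> ((nat \<Rightarrow> 'm) \<times> (nat \<Rightarrow> 'm)) set" where
  "cauchy_equiv S d =
     {(q, q'). q \<in> cauchy_seqs S d \<and> q' \<in> cauchy_seqs S d \<and> (\<lambda>n. d (q n) (q' n)) \<longlonglongrightarrow> 0}"

definition metric_completion :: "'m set \<Rightarrow> ('m \<Rightarrow> 'm \<Rightarrow> ennreal) \<Rightarrow> (nat \<Rightarrow> 'm) set set" where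
  "metric_completion S d = cauchy_seqs S d // cauchy_equiv S d"

definition determines_point ::
  "'m set \<Rightarrow> ('m \<Rightarrow> 'm \<Rightarrow> ennreal) \<Rightarrow> (nat \<Rightarrow> 'm) \<Rightarrow> (nat \<Rightarrow> 'm) set \<Rightarrow> bool" where
  "determines_point S d q \<xi> \<longleftrightarrow> q \<in> cauchy_seqs S d \<and> \<xi> = cauchy_equiv S d `` {q}"

end

(*
  In a chart of corner coordinates the defining functions near p satisfy rho_i >= m x_k(i), so the
  conformal factor is at most C s^(-A_I) wherever all corner coordinates are at least s.  Two
  interior points x, y at distance at most eps from p in the chart are joined by the smooth curve
  (1 - t) x + t y + eps t (1 - t) (1,...,1), which is pushed into the interior by eps t (1 - t) and
  has speed O(eps); its length is O(eps^(1 - a)) times the integral of (t (1 - t))^(-a) with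
  a = A_I / 2 < 1, a Beta integral.  So distances between points near p are small.  The statement
  about the completion then needs only the triangle inequality for the distance.
*)

theory Submission
  imports Defs
begin

text \<open>The segment from x to y is the obvious path, but when x and y lie very close to a face
  it stays there, and the conformal factor along it has no bound in terms of eps. The push keeps
  every corner coordinate above eps t (1 - t) whatever x and y are, so the singularity is met only
  at the two ends and the estimate is uniform in x and y. The assumption A_I < 2 enters twice: it
  makes the singularities at both ends integrable, the length element being the square root of the
  metric, and it makes the exponent of eps positive, one power coming from the speed and -a from the
  conformal factor. The inactive rho_j contribute only constants. The push is polynomial, so the
  curve is one smooth piece; concatenation enters only through the triangle inequality. The
  completion also requires a representative, hence a sequence that approaches p from the interior.
  As \<open>integral\<close> is 0 for non-integrable functions, the length estimates treat that case
  separately.\<close>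

section \<open>Calculus of smooth maps\<close>

text \<open>On an open set the derivative at a point depends only on values inside the set, so the
  equation passes to all iterated derivatives. The closure rules below use this to replace a
  derivative by its computed formula.\<close>

lemma Ck_on_cong:
  assumes "open U" "\<And>x. x \<in> U \<Longrightarrow> f x = g x"
  shows "Ck_on k U f \<longleftrightarrow> Ck_on k U g"
  using assms(2)
proof (induction k arbitrary: f g)
  case 0
  then show ?case by (simp cong: continuous_on_cong)
next
  case (Suc k)
  have *: "(f has_derivative D) (at x) \<longleftrightarrow> (g has_derivative D) (at x)" if "x \<in> U" for x D
    using has_derivative_transform_within_open[OF _ \<open>open U\<close> that] Suc.prems by metis
  then have "frechet_derivative f (at x) v = frechet_derivative g (at x) v" if "x \<in> U" for x v
    using that by (simp add: frechet_derivative_def)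
  then have "Ck_on k U (\<lambda>x. frechet_derivative f (at x) v) \<longleftrightarrow>
      Ck_on k U (\<lambda>x. frechet_derivative g (at x) v)" for v
    by (intro Suc.IH)
  with * show ?case by (auto simp: differentiable_def)
qed

lemma Ck_on_subset: "Ck_on k U f \<Longrightarrow> V \<subseteq> U \<Longrightarrow> Ck_on k V f"
  by (induction k arbitrary: f) (auto intro: continuous_on_subset)

lemma Ck_on_Suc_imp: "Ck_on (Suc k) U f \<Longrightarrow> Ck_on k U f"
proof (induction k arbitrary: f)
  case 0
  then show ?case
    by (auto intro!: continuous_at_imp_continuous_on differentiable_imp_continuous_within)
next
  case (Suc k)
  then show ?case by (metis Ck_on.simps(2))
qed

lemma Ck_on_const: "Ck_on k U (\<lambda>_. c)"
  by (induction k arbitrary: c) (auto simp: frechet_derivative_const)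

lemma Ck_on_add:
  assumes "open U" "Ck_on k U f" "Ck_on k U g"
  shows "Ck_on k U (\<lambda>x. f x + g x)"
  using assms(2,3)
proof (induction k arbitrary: f g)
  case 0
  then show ?case by (simp add: continuous_on_add)
next
  case (Suc k)
  have "frechet_derivative (\<lambda>x. f x + g x) (at x) v =
      frechet_derivative f (at x) v + frechet_derivative g (at x) v" if "x \<in> U" for x v
    using Suc.prems that
    by (intro frechet_derivative_at[symmetric, THEN fun_cong] has_derivative_add)
       (simp_all add: frechet_derivative_works[symmetric])
  then have "Ck_on k U (\<lambda>x. frechet_derivative (\<lambda>x. f x + g x) (at x) v)" for v
    using Suc by (subst Ck_on_cong[OF \<open>open U\<close>]) auto
  with Suc.prems show ?case by simp
qed

lemma Ck_on_sum:
  assumes "open U" "\<And>b. b \<in> B \<Longrightarrow> Ck_on k U (f b)"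
  shows "Ck_on k U (\<lambda>x. \<Sum>b\<in>B. f b x)"
  using assms(2)
  by (induction B rule: infinite_finite_induct) (simp_all add: Ck_on_const Ck_on_add[OF assms(1)])

lemma Ck_on_bounded_linear_compose:
  assumes "open U" "bounded_linear h" "Ck_on k U f"
  shows "Ck_on k U (\<lambda>x. h (f x))"
  using assms(3)
proof (induction k arbitrary: f)
  case 0
  then show ?case by (simp add: bounded_linear.continuous_on[OF assms(2)])
next
  case (Suc k)
  have *: "((\<lambda>x. h (f x)) has_derivative (\<lambda>v. h (frechet_derivative f (at x) v))) (at x)"
    if "x \<in> U" for x
    using Suc.prems that
    by (intro bounded_linear.has_derivative[OF assms(2)])
       (simp add: frechet_derivative_works[symmetric])
  then have "Ck_on k U (\<lambda>x. frechet_derivative (\<lambda>x. h (f x)) (at x) v)" for v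
    using Suc by (subst Ck_on_cong[OF \<open>open U\<close>, where g = "\<lambda>x. h (frechet_derivative f (at x) v)"])
      (auto simp: frechet_derivative_at[OF *, symmetric])
  with * show ?case by (auto simp: differentiable_def)
qed

lemma Ck_on_scaleR:
  fixes p :: "'a::real_normed_vector \<Rightarrow> real"
  assumes "open U" "Ck_on k U p" "Ck_on k U f"
  shows "Ck_on k U (\<lambda>x. p x *\<^sub>R f x)"
  using assms(2,3)
proof (induction k arbitrary: p f)
  case 0
  then show ?case by (simp add: continuous_on_scaleR)
next
  case (Suc k)
  have *: "((\<lambda>x. p x *\<^sub>R f x) has_derivative (\<lambda>v. p x *\<^sub>R frechet_derivative f (at x) v
      + frechet_derivative p (at x) v *\<^sub>R f x)) (at x)" if "x \<in> U" for x
    using Suc.prems that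
    by (intro has_derivative_scaleR) (simp_all add: frechet_derivative_works[symmetric])
  \<comment> \<open>Each summand of the product rule keeps one undifferentiated factor, known one
    order too high; \<open>Ck_on_Suc_imp\<close> lowers it.\<close>
  have "Ck_on k U (\<lambda>x. p x *\<^sub>R frechet_derivative f (at x) v + frechet_derivative p (at x) v *\<^sub>R f x)"
    for v
    using Suc.IH Suc.prems Suc.prems[THEN Ck_on_Suc_imp] by (intro Ck_on_add[OF assms(1)]) auto
  then have "Ck_on k U (\<lambda>x. frechet_derivative (\<lambda>x. p x *\<^sub>R f x) (at x) v)" for v
    by (subst Ck_on_cong[OF \<open>open U\<close>]) (auto simp: frechet_derivative_at[OF *, symmetric])
  with * show ?case by (auto simp: differentiable_def)
qed

lemma Ck_on_bounded_linear:
  assumes "bounded_linear h"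
  shows "Ck_on k U h"
proof (cases k)
  case 0
  then show ?thesis by (simp add: linear_continuous_on assms)
next
  case (Suc j)
  have "frechet_derivative h (at x) = h" for x
    using frechet_derivative_at[OF bounded_linear_imp_has_derivative[OF assms]] by simp
  with Suc show ?thesis
    by (simp add: Ck_on_const bounded_linear_imp_differentiable assms)
qed

text \<open>Induction through the chain rule. The direction fed to the derivative of
  \<open>F\<close> moves with the point, whereas \<open>Ck_on\<close> controls derivatives in fixed
  directions; expanding in \<open>Basis\<close> bridges this, hence the Euclidean middle
  space.\<close>

lemma Ck_on_compose:
  fixes F :: "'b::euclidean_space \<Rightarrow> 'c::real_normed_vector" and L :: "'a::real_normed_vector \<Rightarrow> 'b"
  assumes "open V" "L ` V \<subseteq> U" "Ck_on k U F" "Ck_on k V L"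
  shows "Ck_on k V (\<lambda>s. F (L s))"
  using assms(3,4)
proof (induction k arbitrary: F)
  case 0
  then show ?case using assms(2) by (auto intro: continuous_on_compose2)
next
  case (Suc k)
  let ?F = "\<lambda>x. frechet_derivative F (at x)" and ?L = "\<lambda>s. frechet_derivative L (at s)"
  have FD: "(F has_derivative ?F (L s)) (at (L s))" if "s \<in> V" for s
    using Suc.prems(1) that assms(2) by (auto simp: frechet_derivative_works[symmetric])
  have LD: "(L has_derivative ?L s) (at s)" if "s \<in> V" for s
    using Suc.prems(2) that by (auto simp: frechet_derivative_works[symmetric])
  have *: "((\<lambda>s. F (L s)) has_derivative (\<lambda>v. ?F (L s) (?L s v))) (at s)" if "s \<in> V" for s
    using has_derivative_compose[OF LD FD] that by blast
  have "?F (L s) (?L s v) = (\<Sum>b\<in>Basis. (?L s v \<bullet> b) *\<^sub>R ?F (L s) b)" if "s \<in> V" for s v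
  proof -
    have "linear (?F (L s))" using FD[OF that] by (rule has_derivative_linear)
    then have "?F (L s) (\<Sum>b\<in>Basis. (?L s v \<bullet> b) *\<^sub>R b) = (\<Sum>b\<in>Basis. (?L s v \<bullet> b) *\<^sub>R ?F (L s) b)"
      by (simp add: linear_sum linear_scale)
    then show ?thesis by (simp add: euclidean_representation)
  qed
  moreover have "Ck_on k V (\<lambda>s. \<Sum>b\<in>Basis. (?L s v \<bullet> b) *\<^sub>R ?F (L s) b)" for v
  proof (intro Ck_on_sum Ck_on_scaleR assms(1))
    fix b :: 'b
    show "Ck_on k V (\<lambda>s. ?L s v \<bullet> b)"
      using Suc.prems(2)
      by (intro Ck_on_bounded_linear_compose[OF assms(1), where h = "\<lambda>z. z \<bullet> b"]
          bounded_linear_inner_left) simp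
    show "Ck_on k V (\<lambda>s. ?F (L s) b)"
      using Suc.prems(1) Ck_on_Suc_imp[OF Suc.prems(2)] by (intro Suc.IH) simp_all
  qed
  ultimately have "Ck_on k V (\<lambda>s. frechet_derivative (\<lambda>s. F (L s)) (at s) v)" for v
    by (subst Ck_on_cong[OF \<open>open V\<close>,
          where g = "\<lambda>s. \<Sum>b\<in>Basis. (?L s v \<bullet> b) *\<^sub>R ?F (L s) b"])
       (simp_all only: frechet_derivative_at[OF *, symmetric])
  with * show ?case by (auto simp: differentiable_def)
qed

lemma smooth_onE:
  assumes "smooth_on S f" "x \<in> S"
  obtains U F where "open U" "x \<in> U" "\<And>k. Ck_on k U F" "\<And>y. y \<in> S \<inter> U \<Longrightarrow> F y = f y"
proof -
  from bspec[OF assms(1)[unfolded smooth_on_def] assms(2)]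
  obtain U F where "open U" "x \<in> U" "\<forall>k. Ck_on k U F" "\<forall>y\<in>S \<inter> U. F y = f y"
    by (elim exE conjE)
  then show ?thesis by (intro that[of U F]) simp_all
qed

text \<open>The local extension agrees with \<open>f\<close> on \<open>S\<close> near
  \<open>x\<close>, so its full derivative restricts to one within \<open>S\<close>.
  \<open>F\<close> is returned as well because its derivatives at neighbouring points are used
  later.\<close>

lemma smooth_on_imp_has_derivative:
  assumes "smooth_on S f" "x \<in> S"
  obtains U F where "open U" "x \<in> U" "\<And>k. Ck_on k U F" "\<And>y. y \<in> S \<inter> U \<Longrightarrow> F y = f y"
    "(f has_derivative frechet_derivative F (at x)) (at x within S)"
proof -
  obtain U F where UF: "open U" "x \<in> U" "\<And>k. Ck_on k U F" "\<And>y. y \<in> S \<inter> U \<Longrightarrow> F y = f y"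
    using assms by (rule smooth_onE) (rule that)
  have "F differentiable (at x)" using UF(2) UF(3)[of 1] by simp
  then have "(F has_derivative frechet_derivative F (at x)) (at x within S)"
    using frechet_derivative_works has_derivative_at_withinI by blast
  moreover have "eventually (\<lambda>y. y \<in> U) (at x within S)"
    using UF(1,2) by (meson eventually_at_topological)
  then have "eventually (\<lambda>y. F y = f y) (at x within S)"
    using UF(4) unfolding eventually_at_filter by (auto elim: eventually_mono)
  ultimately have "(f has_derivative frechet_derivative F (at x)) (at x within S)"
    using assms(2) UF(2,4) by (auto intro: has_derivative_transform_eventually)
  with UF show ?thesis by (rule that)
qed

lemma smooth_on_imp_continuous_on: "smooth_on S f \<Longrightarrow> continuous_on S f"
  unfolding continuous_on_eq_continuous_within
  by (metis smooth_on_imp_has_derivative has_derivative_continuous)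

text \<open>The inner map is smooth everywhere, so local extensions of \<open>f\<close> pull back
  along it. The equation for \<open>h\<close> is asked on \<open>R\<close> only, which fits a piece
  of a concatenated curve.\<close>

lemma smooth_on_compose:
  fixes f :: "'b::euclidean_space \<Rightarrow> 'c::real_normed_vector" and L :: "'a::real_normed_vector \<Rightarrow> 'b"
  assumes "smooth_on S f" "\<And>k. Ck_on k UNIV L" "L ` R \<subseteq> S" "\<And>s. s \<in> R \<Longrightarrow> h s = f (L s)"
  shows "smooth_on R h"
  unfolding smooth_on_def
proof
  fix s assume "s \<in> R"
  then have "L s \<in> S" using assms(3) by auto
  then obtain U F where UF: "open U" "L s \<in> U" "\<And>k. Ck_on k U F" "\<And>y. y \<in> S \<inter> U \<Longrightarrow> F y = f y"
    using smooth_onE[OF assms(1) \<open>L s \<in> S\<close>] by metis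
  have op: "open (L -` U)"
    using assms(2)[of 0] UF(1) by (simp add: continuous_on_open_vimage)
  moreover have "Ck_on k (L -` U) (\<lambda>s. F (L s))" for k
    by (rule Ck_on_compose[where U = U]) (auto simp: op UF(3) intro: Ck_on_subset[OF assms(2)])
  ultimately show "\<exists>V G. open V \<and> s \<in> V \<and> (\<forall>k. Ck_on k V G) \<and> (\<forall>y\<in>R \<inter> V. G y = h y)"
    using UF(2,4) assms(3,4) by (intro exI[of _ "L -` U"] exI[of _ "\<lambda>s. F (L s)"]) auto
qed

section \<open>Charts\<close>

lemma chart_basics:
  assumes "manifold_with_corners A" "c \<in> A"
  shows chart_dom_open: "open (chart_dom c)"
    and chart_image_openin: "openin (top_of_set (corner_model (chart_corner c))) (chart_map c ` chart_dom c)"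
    and chart_inv_map: "q \<in> chart_dom c \<Longrightarrow> chart_inv c (chart_map c q) = q"
    and chart_map_inv: "x \<in> chart_map c ` chart_dom c \<Longrightarrow> chart_map c (chart_inv c x) = x"
    and chart_inv_dom: "x \<in> chart_map c ` chart_dom c \<Longrightarrow> chart_inv c x \<in> chart_dom c"
    and chart_map_continuous: "continuous_on (chart_dom c) (chart_map c)"
    and chart_inv_continuous: "continuous_on (chart_map c ` chart_dom c) (chart_inv c)"
proof -
  have *: "is_corner_chart c" using assms by (auto simp: manifold_with_corners_def)
  then have h: "homeomorphism (chart_dom c) (chart_map c ` chart_dom c) (chart_map c) (chart_inv c)"
    by (simp add: is_corner_chart_def)
  from * show "open (chart_dom c)"
    "openin (top_of_set (corner_model (chart_corner c))) (chart_map c ` chart_dom c)"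
    by (simp_all add: is_corner_chart_def)
  from h show "q \<in> chart_dom c \<Longrightarrow> chart_inv c (chart_map c q) = q"
    "x \<in> chart_map c ` chart_dom c \<Longrightarrow> chart_map c (chart_inv c x) = x"
    "x \<in> chart_map c ` chart_dom c \<Longrightarrow> chart_inv c x \<in> chart_dom c"
    "continuous_on (chart_dom c) (chart_map c)"
    "continuous_on (chart_map c ` chart_dom c) (chart_inv c)"
    by (auto simp: homeomorphism_def)
qed

lemma chart_map_corner:
  assumes "manifold_with_corners A" "c \<in> A" "q \<in> chart_dom c" "k \<in> chart_corner c"
  shows "0 \<le> chart_map c q $ k"
  using openin_imp_subset[OF chart_image_openin[OF assms(1,2)]] assms(3,4)
  by (auto simp: corner_model_def)

lemma charts_atD: "c \<in> charts_at A q \<Longrightarrow> c \<in> A" "c \<in> charts_at A q \<Longrightarrow> q \<in> chart_dom c"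
  by (auto simp: charts_at_def)

lemma charts_at_nonempty:
  assumes "manifold_with_corners A"
  obtains c where "c \<in> charts_at A q"
proof -
  have "q \<in> (\<Union>c\<in>A. chart_dom c)" using assms by (simp add: manifold_with_corners_def)
  then show ?thesis using that by (auto simp: charts_at_def)
qed

lemma mfd_interior_coord_pos:
  assumes "manifold_with_corners A" "c \<in> charts_at A q" "q \<in> mfd_interior A" "k \<in> chart_corner c"
  shows "0 < chart_map c q $ k"
proof -
  have "chart_map c q $ k \<noteq> 0"
    using assms by (auto simp: mfd_interior_def mfd_boundary_def vanishing_coords_def)
  moreover have "0 \<le> chart_map c q $ k"
    using chart_map_corner[OF assms(1)] assms(2,4) by (auto simp: charts_at_def)
  ultimately show ?thesis by simp
qed

text \<open>By invariance of domain the corner coordinates of another chart cannot vanish at a point that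
  has a full Euclidean neighbourhood in one chart.\<close>

lemma coord_pos_imp_mfd_interior:
  assumes man: "manifold_with_corners A" and c: "c \<in> charts_at A q"
    and pos: "\<And>k. k \<in> chart_corner c \<Longrightarrow> 0 < chart_map c q $ k"
  shows "q \<in> mfd_interior A"
proof (rule ccontr)
  assume "q \<notin> mfd_interior A"
  then obtain d i where d: "d \<in> charts_at A q" and i: "i \<in> chart_corner d" "chart_map d q $ i = 0"
    by (auto simp: mfd_interior_def mfd_boundary_def vanishing_coords_def)
  note cA = charts_atD(1)[OF c] and qc = charts_atD(2)[OF c]
  note dA = charts_atD(1)[OF d] and qd = charts_atD(2)[OF d]
  let ?U = "chart_map c ` chart_dom c"
  obtain O' where O': "open O'" "?U = corner_model (chart_corner c) \<inter> O'"
    using chart_image_openin[OF man cA] by (auto simp: openin_open)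
  obtain O2 where O2: "open O2" "chart_inv c -` chart_dom d \<inter> ?U = O2 \<inter> ?U"
    using chart_inv_continuous[OF man cA] chart_dom_open[OF man dA]
    by (auto simp: continuous_on_open_invariant)
  define P where "P = {x :: real ^ 'b. \<forall>k\<in>chart_corner c. 0 < x $ k}"
  have "P = (\<Inter>k\<in>chart_corner c. {x. 0 < x $ k})" by (auto simp: P_def)
  then have "open P"
    by (auto intro!: open_INT open_Collect_less continuous_intros)
  \<comment> \<open>The strict inequalities in \<open>P\<close> make \<open>S\<close> open in the
    whole space and not just in the corner, as invariance of domain requires.\<close>
  define S where "S = P \<inter> O' \<inter> O2"
  have "open S" using \<open>open P\<close> O'(1) O2(1) by (auto simp: S_def)
  have "P \<subseteq> corner_model (chart_corner c)" by (auto simp: P_def corner_model_def less_imp_le)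
  then have SU: "S \<subseteq> ?U" using O'(2) by (auto simp: S_def)
  have Sd: "chart_inv c x \<in> chart_dom d" if "x \<in> S" for x
    using SU that O2(2) by (auto simp: S_def)
  have "chart_map c q \<in> S"
    using pos qc qd O'(2) O2(2) chart_inv_map[OF man cA qc] by (auto simp: S_def P_def)
  let ?f = "chart_map d \<circ> chart_inv c"
  have "continuous_on S ?f"
    using Sd chart_map_continuous[OF man dA]
    by (intro continuous_on_compose continuous_on_subset[OF chart_inv_continuous[OF man cA] SU])
       (auto intro: continuous_on_subset)
  moreover have "inj_on ?f S"
  proof (rule inj_onI)
    fix x y assume xy: "x \<in> S" "y \<in> S" "?f x = ?f y"
    then have "chart_inv c x = chart_inv c y"
      by (metis Sd chart_inv_map[OF man dA] comp_apply)
    then show "x = y" by (metis SU chart_map_inv[OF man cA] subsetD xy(1,2))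
  qed
  ultimately have "open (?f ` S)" by (intro invariance_of_domain \<open>open S\<close>)
  moreover have "chart_map d q \<in> ?f ` S"
    using \<open>chart_map c q \<in> S\<close> chart_inv_map[OF man cA qc] by (auto intro!: image_eqI)
  ultimately obtain e where e: "e > 0" "ball (chart_map d q) e \<subseteq> ?f ` S"
    by (meson open_contains_ball)
  \<comment> \<open>A point of the ball just beyond the wall \<open>x $ i = 0\<close>, where the
    chart \<open>d\<close> takes no values.\<close>
  let ?y = "chart_map d q - (e/2) *\<^sub>R axis i 1"
  have "?y \<in> ball (chart_map d q) e" using e(1) by (simp add: dist_norm)
  then have "?y \<in> ?f ` S" using e(2) by blast
  then obtain x where "x \<in> S" "?y = chart_map d (chart_inv c x)" by auto
  then have "0 \<le> ?y $ i" using chart_map_corner[OF man dA Sd i(1)] by metis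
  then show False using i(2) e(1) by simp
qed

section \<open>Velocities\<close>

lemma transition_has_derivative:
  assumes "manifold_with_corners A" "c \<in> charts_at A q" "d \<in> charts_at A q"
  obtains D where "((chart_map d \<circ> chart_inv c) has_derivative D)
    (at (chart_map c q) within chart_map c ` (chart_dom c \<inter> chart_dom d))"
proof -
  have "smooth_on (chart_map c ` (chart_dom c \<inter> chart_dom d)) (chart_map d \<circ> chart_inv c)"
    using assms by (auto simp: manifold_with_corners_def charts_at_def)
  moreover have "chart_map c q \<in> chart_map c ` (chart_dom c \<inter> chart_dom d)"
    using assms by (auto simp: charts_at_def)
  ultimately show ?thesis by (rule smooth_on_imp_has_derivative) (rule that)
qed

lemma tangent_space_scaleR:
  assumes "v \<in> tangent_space A q"
  shows "(\<lambda>c. m *\<^sub>R v c) \<in> tangent_space A q"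
proof -
  have *: "m *\<^sub>R D w = D (m *\<^sub>R w)" if "(f has_derivative D) F" for D f F w
    using has_derivative_linear[OF that] by (simp add: linear_scale)
  show ?thesis
    using assms unfolding tangent_space_def mem_Collect_eq
    by (metis (no_types, lifting) * scale_zero_right)
qed

text \<open>The transition law is the chain rule for the curve read in one chart followed by the
  change of charts. It is available wherever the coordinate curves are differentiable, hence off the
  break points.\<close>

lemma velocity_in_tangent_space:
  fixes A :: "('m::{t2_space, second_countable_topology}, 'n::finite) corner_chart set"
  assumes man: "manifold_with_corners A" and cont: "continuous_on {0..1} \<gamma>" and t: "t \<in> {0<..<1}"
    and diff: "\<And>c. c \<in> charts_at A (\<gamma> t) \<Longrightarrow> (chart_map c \<circ> \<gamma>) differentiable (at t)"
  shows "velocity A \<gamma> t \<in> tangent_space A (\<gamma> t)"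
    and "c \<in> charts_at A (\<gamma> t) \<Longrightarrow> ((chart_map c \<circ> \<gamma>) has_vector_derivative velocity A \<gamma> t c) (at t)"
proof -
  have vel: "((chart_map c \<circ> \<gamma>) has_vector_derivative velocity A \<gamma> t c) (at t)"
    if "c \<in> charts_at A (\<gamma> t)" for c
    using diff[OF that] that t
    by (simp add: velocity_def at_within_Icc_at vector_derivative_works)
  then show "c \<in> charts_at A (\<gamma> t) \<Longrightarrow>
    ((chart_map c \<circ> \<gamma>) has_vector_derivative velocity A \<gamma> t c) (at t)" .
  show "velocity A \<gamma> t \<in> tangent_space A (\<gamma> t)"
    unfolding tangent_space_def mem_Collect_eq
  proof (intro conjI allI impI ballI)
    fix c assume "c \<notin> charts_at A (\<gamma> t)"
    then show "velocity A \<gamma> t c = 0" by (simp add: velocity_def)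
  next
    fix c d assume c: "c \<in> charts_at A (\<gamma> t)" and d: "d \<in> charts_at A (\<gamma> t)"
    obtain D where D: "((chart_map d \<circ> chart_inv c) has_derivative D)
        (at (chart_map c (\<gamma> t)) within chart_map c ` (chart_dom c \<inter> chart_dom d))"
      using transition_has_derivative[OF man c d] .
    \<comment> \<open>The transition map has a derivative only within the overlap, so time is
      restricted to an open set on which the curve stays in both chart domains.\<close>
    define N where "N = {0<..<1} \<inter> \<gamma> -` (chart_dom c \<inter> chart_dom d)"
    have "continuous_on {0<..<1} \<gamma>" by (rule continuous_on_subset[OF cont]) auto
    then have "open N" unfolding N_def
      by (intro continuous_open_preimage open_Int chart_dom_open[OF man])
         (auto simp: charts_atD(1)[OF c] charts_atD(1)[OF d])
    have tN: "t \<in> N" using t c d by (auto simp: N_def charts_at_def)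
    have sub: "(chart_map c \<circ> \<gamma>) ` N \<subseteq> chart_map c ` (chart_dom c \<inter> chart_dom d)"
      by (auto simp: N_def)
    have "((chart_map c \<circ> \<gamma>) has_derivative (\<lambda>h. h *\<^sub>R velocity A \<gamma> t c)) (at t within N)"
      using vel[OF c] by (auto simp: has_vector_derivative_def intro: has_derivative_at_withinI)
    from diff_chain_within[OF this, of "chart_map d \<circ> chart_inv c" D]
    have "(((chart_map d \<circ> chart_inv c) \<circ> (chart_map c \<circ> \<gamma>)) has_derivative
        (D \<circ> (\<lambda>h. h *\<^sub>R velocity A \<gamma> t c))) (at t)"
      using has_derivative_subset[OF D sub] at_within_open[OF tN \<open>open N\<close>] by simp
    moreover have "((chart_map d \<circ> chart_inv c) \<circ> (chart_map c \<circ> \<gamma>)) s = (chart_map d \<circ> \<gamma>) s"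
      if "s \<in> N" for s
      using that chart_inv_map[OF man charts_atD(1)[OF c]] by (auto simp: N_def)
    ultimately have "((chart_map d \<circ> \<gamma>) has_derivative (D \<circ> (\<lambda>h. h *\<^sub>R velocity A \<gamma> t c))) (at t)"
      using has_derivative_transform_within_open[OF _ \<open>open N\<close> tN] by blast
    moreover have "D \<circ> (\<lambda>h. h *\<^sub>R velocity A \<gamma> t c) = (\<lambda>h. h *\<^sub>R D (velocity A \<gamma> t c))"
      using has_derivative_linear[OF D] by (auto simp: linear_scale)
    ultimately have "((chart_map d \<circ> \<gamma>) has_vector_derivative D (velocity A \<gamma> t c)) (at t)"
      by (simp add: has_vector_derivative_def)
    then have "velocity A \<gamma> t d = D (velocity A \<gamma> t c)"
      using vel[OF d] vector_derivative_unique_at by blast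
    with D show "\<exists>D. ((chart_map d \<circ> chart_inv c) has_derivative D)
        (at (chart_map c (\<gamma> t)) within chart_map c ` (chart_dom c \<inter> chart_dom d)) \<and>
        velocity A \<gamma> t d = D (velocity A \<gamma> t c)" by blast
  qed
qed

text \<open>The exceptional set consists of the break points, so a single finite set serves all
  charts.\<close>

lemma piecewise_smooth_curve_differentiable:
  fixes A :: "('m::{t2_space, second_countable_topology}, 'n::finite) corner_chart set"
  assumes man: "manifold_with_corners A" and "piecewise_smooth_curve A \<gamma>"
  obtains T where "finite T"
    "\<And>t c. \<lbrakk>t \<in> {0<..<1} - T; c \<in> charts_at A (\<gamma> t)\<rbrakk> \<Longrightarrow> (chart_map c \<circ> \<gamma>) differentiable (at t)"
proof -
  obtain T where T: "finite T" "{0, 1} \<subseteq> T" "T \<subseteq> {0..1}"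
    and sm: "\<And>a b c. \<lbrakk>a \<in> T; b \<in> T; a < b; {a<..<b} \<inter> T = {}; c \<in> A\<rbrakk> \<Longrightarrow>
           smooth_on {s\<in>{a..b}. \<gamma> s \<in> chart_dom c} (chart_map c \<circ> \<gamma>)"
    and cont: "continuous_on {0..1} \<gamma>"
    using assms(2)[unfolded piecewise_smooth_curve_def] by (elim conjE exE) simp
  show ?thesis
  proof (rule that[OF T(1)])
    fix t c assume t: "t \<in> {0<..<1} - T" and c: "c \<in> charts_at A (\<gamma> t)"
    \<comment> \<open>The neighbours of \<open>t\<close> among the break points; they exist because
      0 and 1 are break points.\<close>
    define a where "a = Max {s\<in>T. s < t}"
    define b where "b = Min {s\<in>T. t < s}"
    have a: "a \<in> {s\<in>T. s < t}" unfolding a_def using T t by (intro Max_in) auto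
    have b: "b \<in> {s\<in>T. t < s}" unfolding b_def using T t by (intro Min_in) auto
    have le_a: "s \<le> a" if "s \<in> T" "s < t" for s
      unfolding a_def using that T(1) by (intro Max_ge) auto
    have b_le: "b \<le> s" if "s \<in> T" "t < s" for s
      unfolding b_def using that T(1) by (intro Min_le) auto
    have gap: "{a<..<b} \<inter> T = {}"
    proof (rule equals0I)
      fix s assume "s \<in> {a<..<b} \<inter> T"
      then show False using le_a[of s] b_le[of s] t by (cases s t rule: linorder_cases) auto
    qed
    let ?S = "{s\<in>{a..b}. \<gamma> s \<in> chart_dom c}"
    have "smooth_on ?S (chart_map c \<circ> \<gamma>)"
      using a b gap charts_atD(1)[OF c] by (intro sm) auto
    moreover have "t \<in> ?S" using a b c by (auto simp: charts_at_def)
    ultimately obtain U F where UF: "open U" "t \<in> U" "\<And>k. Ck_on k U F"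
        "\<And>y. y \<in> ?S \<inter> U \<Longrightarrow> F y = (chart_map c \<circ> \<gamma>) y"
      by (rule smooth_onE) (rule that)
    \<comment> \<open>\<open>t\<close> is interior to its piece, so the extension \<open>F\<close>
      equals the coordinate curve on both sides of \<open>t\<close> and the derivative is
      two-sided.\<close>
    define N where "N = ({a<..<b} \<inter> \<gamma> -` chart_dom c) \<inter> U"
    have "0 \<le> a" "b \<le> 1" using a b T(3) by auto
    then have "continuous_on {a<..<b} \<gamma>" by (intro continuous_on_subset[OF cont]) auto
    then have "open N" unfolding N_def
      by (intro continuous_open_preimage open_Int chart_dom_open[OF man] UF charts_atD(1)[OF c]) auto
    moreover have "t \<in> N" using UF(2) \<open>t \<in> ?S\<close> a b by (auto simp: N_def)
    moreover obtain D where "(F has_derivative D) (at t)"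
      using UF(2) UF(3)[of 1] by (auto simp: differentiable_def)
    ultimately have "((chart_map c \<circ> \<gamma>) has_derivative D) (at t)"
      by (elim has_derivative_transform_within_open) (auto simp: N_def UF(4))
    then show "(chart_map c \<circ> \<gamma>) differentiable (at t)" by (auto simp: differentiable_def)
  qed
qed

text \<open>The agreement is local, on \<open>W\<close>, since a concatenation is a
  reparametrization of one given piece only on half of the interval.\<close>

lemma velocity_affine_reparametrization:
  fixes A :: "('m::{t2_space, second_countable_topology}, 'n::finite) corner_chart set"
  assumes "open W" "t \<in> W" "\<And>s. s \<in> W \<Longrightarrow> \<gamma> s = \<eta> (m * s + b)"
    and t: "t \<in> {0<..<1}" and u: "m * t + b \<in> {0<..<1}"
    and diff: "\<And>c. c \<in> charts_at A (\<eta> (m * t + b)) \<Longrightarrow> (chart_map c \<circ> \<eta>) differentiable (at (m * t + b))"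
  shows "velocity A \<gamma> t = (\<lambda>c. m *\<^sub>R velocity A \<eta> (m * t + b) c)"
proof
  fix c
  have eq: "\<gamma> t = \<eta> (m * t + b)" using assms by simp
  show "velocity A \<gamma> t c = m *\<^sub>R velocity A \<eta> (m * t + b) c"
  proof (cases "c \<in> charts_at A (\<gamma> t)")
    case True
    then have "((chart_map c \<circ> \<eta>) has_vector_derivative velocity A \<eta> (m * t + b) c) (at (m * t + b))"
      using diff[of c] eq u by (simp add: velocity_def at_within_Icc_at vector_derivative_works)
    moreover have "((\<lambda>s. m * s + b) has_vector_derivative m) (at t)"
      by (auto intro!: derivative_eq_intros simp: has_real_derivative_iff_has_vector_derivative[symmetric])
    ultimately have "((chart_map c \<circ> \<eta> \<circ> (\<lambda>s. m * s + b)) has_vector_derivative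
        m *\<^sub>R velocity A \<eta> (m * t + b) c) (at t)"
      by (intro vector_diff_chain_at)
    then have "((chart_map c \<circ> \<gamma>) has_vector_derivative m *\<^sub>R velocity A \<eta> (m * t + b) c) (at t)"
      using assms(3) by (elim has_vector_derivative_transform_within_open[OF _ assms(1,2)]) auto
    then show ?thesis
      using True t by (simp add: velocity_def at_within_Icc_at vector_derivative_at)
  next
    case False
    then show ?thesis using eq by (simp add: velocity_def)
  qed
qed

section \<open>Concatenation of curves and the triangle inequality\<close>

lemma Ck_on_affine: "Ck_on k UNIV (\<lambda>s::real. m * s + b :: real)"
  by (intro Ck_on_add Ck_on_const Ck_on_bounded_linear bounded_linear_mult_right) auto

lemma piecewise_smooth_curve_join:
  assumes "piecewise_smooth_curve A \<gamma>1" "piecewise_smooth_curve A \<gamma>2" "\<gamma>1 1 = \<gamma>2 0"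
  shows "piecewise_smooth_curve A (\<gamma>1 +++ \<gamma>2)"
proof -
  let ?\<gamma> = "\<gamma>1 +++ \<gamma>2"
  obtain T1 where T1: "finite T1" "{0, 1} \<subseteq> T1" "T1 \<subseteq> {0..1}"
    and sm1: "\<And>a b c. \<lbrakk>a \<in> T1; b \<in> T1; a < b; {a<..<b} \<inter> T1 = {}; c \<in> A\<rbrakk> \<Longrightarrow>
           smooth_on {s\<in>{a..b}. \<gamma>1 s \<in> chart_dom c} (chart_map c \<circ> \<gamma>1)"
    and cont1: "continuous_on {0..1} \<gamma>1"
    using assms(1)[unfolded piecewise_smooth_curve_def] by (elim conjE exE) simp
  obtain T2 where T2: "finite T2" "{0, 1} \<subseteq> T2" "T2 \<subseteq> {0..1}"
    and sm2: "\<And>a b c. \<lbrakk>a \<in> T2; b \<in> T2; a < b; {a<..<b} \<inter> T2 = {}; c \<in> A\<rbrakk> \<Longrightarrow>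
           smooth_on {s\<in>{a..b}. \<gamma>2 s \<in> chart_dom c} (chart_map c \<circ> \<gamma>2)"
    and cont2: "continuous_on {0..1} \<gamma>2"
    using assms(2)[unfolded piecewise_smooth_curve_def] by (elim conjE exE) simp
  \<comment> \<open>Both sets of break points, moved to their halves. They contribute 1/2, so no gap
    between neighbouring points straddles the junction.\<close>
  define T where "T = (\<lambda>s. s / 2) ` T1 \<union> (\<lambda>s. (s + 1) / 2) ` T2"
  have left: "?\<gamma> s = \<gamma>1 (2 * s + 0)" if "s \<le> 1/2" for s
    using that by (simp add: joinpaths_def)
  have right: "?\<gamma> s = \<gamma>2 (2 * s + -1)" if "1/2 \<le> s" for s
  proof (cases "s = 1/2")
    case False
    then show ?thesis using that by (simp add: joinpaths_def)
  next
    case True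
    then show ?thesis unfolding True by (simp add: joinpaths_def assms(3))
  qed
  have left_T: "2 * a \<in> T1" if a: "a \<in> T" "a \<le> 1/2" for a
    using a(1) unfolding T_def
  proof
    \<comment> \<open>A point of the second half that is at most 1/2 is the junction, which
      corresponds to the end point 1 of the first curve.\<close>
    assume "a \<in> (\<lambda>s. (s + 1) / 2) ` T2"
    then have "2 * a = 1" using a(2) T2(3) by force
    then show ?thesis using T1(2) by (simp del: mult_2)
  qed auto
  have right_T: "2 * a + -1 \<in> T2" if a: "a \<in> T" "1/2 \<le> a" for a
    using a(1) unfolding T_def
  proof
    assume "a \<in> (\<lambda>s. s / 2) ` T1"
    then have "2 * a + -1 = 0" using a(2) T1(3) by force
    then show ?thesis using T2(2) by simp
  next
    assume "a \<in> (\<lambda>s. (s + 1) / 2) ` T2"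
    then obtain s where "s \<in> T2" "a = (s + 1) / 2" by blast
    moreover from this(2) have "2 * a + -1 = s" by simp
    ultimately show ?thesis by simp
  qed
  have half: "1/2 \<in> T" using T1(2) by (auto simp: T_def)
  have smooth: "smooth_on {s\<in>{a..b}. ?\<gamma> s \<in> chart_dom c} (chart_map c \<circ> ?\<gamma>)"
    if ab: "a \<in> T" "b \<in> T" "a < b" "{a<..<b} \<inter> T = {}" and c: "c \<in> A" for a b c
  proof -
    have "b \<le> 1/2 \<or> 1/2 \<le> a" using half ab(4) by force
    then show ?thesis
    proof
      assume b: "b \<le> 1/2"
      have "s / 2 \<in> {a<..<b} \<inter> T" if "s \<in> {2*a<..<2*b} \<inter> T1" for s
        using that by (auto simp: T_def)
      then have "{2*a<..<2*b} \<inter> T1 = {}" using ab(4) by blast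
      then have "smooth_on {s\<in>{2*a..2*b}. \<gamma>1 s \<in> chart_dom c} (chart_map c \<circ> \<gamma>1)"
        using ab b c left_T by (intro sm1) auto
      then show ?thesis
        by (rule smooth_on_compose[OF _ Ck_on_affine[where m = 2 and b = 0]])
           (use b in \<open>auto simp: left simp del: add_0_right\<close>)
    next
      assume a: "1/2 \<le> a"
      have "(s + 1) / 2 \<in> {a<..<b} \<inter> T" if "s \<in> {2*a+-1<..<2*b+-1} \<inter> T2" for s
        using that by (auto simp: T_def)
      then have "{2*a+-1<..<2*b+-1} \<inter> T2 = {}" using ab(4) by blast
      then have "smooth_on {s\<in>{2*a+-1..2*b+-1}. \<gamma>2 s \<in> chart_dom c} (chart_map c \<circ> \<gamma>2)"
        using ab a c right_T[of a] right_T[of b] by (intro sm2) auto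
      then show ?thesis
        by (rule smooth_on_compose[OF _ Ck_on_affine[where m = 2 and b = "-1"]])
           (use a in \<open>auto simp: right\<close>)
    qed
  qed
  have "continuous_on {0..1} ?\<gamma>"
    using path_join_imp[of \<gamma>1 \<gamma>2] cont1 cont2 assms(3)
    by (simp add: path_def pathstart_def pathfinish_def)
  moreover have "finite T" using T1(1) T2(1) by (simp add: T_def)
  moreover have "0 / 2 \<in> T" "(1 + 1) / 2 \<in> T"
    unfolding T_def using T1(2) T2(2) by (blast intro: imageI)+
  then have "{0, 1} \<subseteq> T" by simp
  moreover have "T \<subseteq> {0..1}"
    using subsetD[OF T1(3)] subsetD[OF T2(3)] by (fastforce simp: T_def)
  ultimately show ?thesis unfolding piecewise_smooth_curve_def using smooth
    by (intro conjI exI[of _ T]) simp_all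
qed

text \<open>Substitution \<open>s = t / 2 + a\<close>: the Jacobian 1/2 cancels the factor 2 by
  which the speed grows on a half. The finite set \<open>S\<close> absorbs break points and end
  points.\<close>

lemma integral_half_interval:
  fixes f h :: "real \<Rightarrow> real"
  assumes "h integrable_on {a..a + 1/2}" "finite S"
    and "\<And>t. t \<in> {0..1} - S \<Longrightarrow> h (t / 2 + a) = 2 * f t"
  shows "integral {a..a + 1/2} h = integral {0..1} f"
proof -
  let ?i = "integral {a..a + 1/2} h"
  have "(h has_integral ?i) (cbox a (a + 1/2))" using assms(1) by (simp add: integrable_integral)
  from has_integral_affinity[OF this, of "1/2" a]
  have "((\<lambda>t. h (t / 2 + a)) has_integral 2 * ?i) ((\<lambda>x. 2 * x + - (2 * a)) ` {a..a + 1/2})"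
    by simp
  moreover have "(\<lambda>x. 2 * x + - (2 * a)) ` {a..a + 1/2} = {0..1}"
    by (auto simp: image_iff intro!: bexI[of _ "_ / 2 + a"])
  ultimately have "((\<lambda>t. h (t / 2 + a)) has_integral 2 * ?i) {0..1}" by simp
  then have "((\<lambda>t. 2 * f t) has_integral 2 * ?i) {0..1}"
    by (rule has_integral_spike_finite[OF assms(2), rotated]) (simp add: assms(3))
  then have "((\<lambda>t. (1/2) * (2 * f t)) has_integral (1/2) * (2 * ?i)) {0..1}"
    by (rule has_integral_mult_right)
  then have "(f has_integral ?i) {0..1}" by simp
  then show ?thesis by (simp add: integral_unique)
qed

text \<open>No integrability is needed: a non-integrable speed gives the concatenation the length
  \<open>0\<close>, and an integrable one is integrable on both halves.\<close>

lemma curve_length_join_le: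
  fixes A :: "('m::{t2_space, second_countable_topology}, 'n::finite) corner_chart set"
  assumes man: "manifold_with_corners A"
    and g: "\<And>q v m. v \<in> tangent_space A q \<Longrightarrow>
      g q (\<lambda>c. m *\<^sub>R v c) (\<lambda>c. m *\<^sub>R v c) = m\<^sup>2 * g q v v"
    and ps: "piecewise_smooth_curve A \<gamma>1" "piecewise_smooth_curve A \<gamma>2"
  shows "ennreal (curve_length A g (\<gamma>1 +++ \<gamma>2)) \<le>
    ennreal (curve_length A g \<gamma>1) + ennreal (curve_length A g \<gamma>2)"
proof -
  define sp where "sp \<gamma> t = sqrt (g (\<gamma> t) (velocity A \<gamma> t) (velocity A \<gamma> t))" for \<gamma> t
  let ?\<gamma> = "\<gamma>1 +++ \<gamma>2"
  have len: "curve_length A g \<gamma> = integral {0..1} (sp \<gamma>)" for \<gamma>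
    by (simp add: curve_length_def sp_def[abs_def])
  show ?thesis
  proof (cases "sp ?\<gamma> integrable_on {0..1}")
    case False
    then show ?thesis by (simp add: len not_integrable_integral)
  next
    case True
    \<comment> \<open>Running twice as fast doubles the velocity; \<open>g\<close> is quadratically
      homogeneous, so its square root doubles too.\<close>
    have speed: "sp ?\<gamma> t = 2 * sp \<eta> (2 * t + b)"
      if \<eta>: "piecewise_smooth_curve A \<eta>" and W: "open W" "t \<in> W" "\<And>s. s \<in> W \<Longrightarrow> ?\<gamma> s = \<eta> (2 * s + b)"
        and t: "t \<in> {0<..<1}" "2 * t + b \<in> {0<..<1}"
        and diff: "\<And>c. c \<in> charts_at A (\<eta> (2 * t + b)) \<Longrightarrow>
          (chart_map c \<circ> \<eta>) differentiable (at (2 * t + b))"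
      for \<eta> W t b
    proof -
      let ?u = "2 * t + b"
      have "velocity A ?\<gamma> t = (\<lambda>c. 2 *\<^sub>R velocity A \<eta> ?u c)"
        by (rule velocity_affine_reparametrization[OF W t diff])
      moreover have "velocity A \<eta> ?u \<in> tangent_space A (\<eta> ?u)"
        using \<eta> by (intro velocity_in_tangent_space[OF man _ t(2) diff])
          (simp add: piecewise_smooth_curve_def)
      ultimately show ?thesis
        using W by (simp add: sp_def g real_sqrt_mult)
    qed
    obtain T1 where T1: "finite T1" "\<And>t c. \<lbrakk>t \<in> {0<..<1} - T1; c \<in> charts_at A (\<gamma>1 t)\<rbrakk> \<Longrightarrow>
        (chart_map c \<circ> \<gamma>1) differentiable (at t)"
      using piecewise_smooth_curve_differentiable[OF man ps(1)] by metis
    obtain T2 where T2: "finite T2" "\<And>t c. \<lbrakk>t \<in> {0<..<1} - T2; c \<in> charts_at A (\<gamma>2 t)\<rbrakk> \<Longrightarrow>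
        (chart_map c \<circ> \<gamma>2) differentiable (at t)"
      using piecewise_smooth_curve_differentiable[OF man ps(2)] by metis
    have 1: "integral {0..0 + 1/2} (sp ?\<gamma>) = integral {0..1} (sp \<gamma>1)"
    proof (rule integral_half_interval)
      show "sp ?\<gamma> integrable_on {0..0 + 1/2}" by (rule integrable_subinterval_real[OF True]) auto
      show "finite (T1 \<union> {0, 1})" using T1(1) by simp
      fix t :: real assume t: "t \<in> {0..1} - (T1 \<union> {0, 1})"
      then have "sp ?\<gamma> (t / 2 + 0) = 2 * sp \<gamma>1 (2 * (t / 2 + 0) + 0)"
        by (intro speed[OF ps(1), of "{..<1/2}"] T1(2)) (auto simp: joinpaths_def)
      then show "sp ?\<gamma> (t / 2 + 0) = 2 * sp \<gamma>1 t" by simp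
    qed
    have 2: "integral {1/2..1/2 + 1/2} (sp ?\<gamma>) = integral {0..1} (sp \<gamma>2)"
    proof (rule integral_half_interval)
      show "sp ?\<gamma> integrable_on {1/2..1/2 + 1/2}" by (rule integrable_subinterval_real[OF True]) auto
      show "finite (T2 \<union> {0, 1})" using T2(1) by simp
      fix t :: real assume t: "t \<in> {0..1} - (T2 \<union> {0, 1})"
      then have "sp ?\<gamma> (t / 2 + 1/2) = 2 * sp \<gamma>2 (2 * (t / 2 + 1/2) + -1)"
        by (intro speed[OF ps(2), of "{1/2<..}"] T2(2)) (auto simp: joinpaths_def)
      then show "sp ?\<gamma> (t / 2 + 1/2) = 2 * sp \<gamma>2 t" by simp
    qed
    have "curve_length A g ?\<gamma> = curve_length A g \<gamma>1 + curve_length A g \<gamma>2"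
      using Henstock_Kurzweil_Integration.integral_combine[OF _ _ True, of "1/2"] 1 2
      by (simp add: len)
    \<comment> \<open>The assumption on \<open>g\<close> is homogeneity, so a length may be negative
      here (\<open>sqrt\<close> is odd). As \<open>ennreal\<close> cuts off at 0, additivity weakens
      to subadditivity.\<close>
    moreover have "ennreal (a + b) \<le> ennreal a + ennreal b" for a b
    proof (cases "0 \<le> a \<and> 0 \<le> b")
      case False
      then have "ennreal (a + b) \<le> ennreal (max a b)" by (intro ennreal_leI) auto
      also have "\<dots> \<le> ennreal a + ennreal b" by (auto simp: max_def add_increasing add_increasing2)
      finally show ?thesis .
    qed simp
    ultimately show ?thesis by simp
  qed
qed

text \<open>An infimum may fail to be attained, so indices within e/2 of each infimum are
  chosen.\<close>

lemma le_INF_add_INF_ennreal: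
  fixes f :: "'a \<Rightarrow> ennreal" and g :: "'b \<Rightarrow> ennreal"
  assumes "\<And>i j. i \<in> I \<Longrightarrow> j \<in> J \<Longrightarrow> x \<le> f i + g j"
  shows "x \<le> (INF i\<in>I. f i) + (INF j\<in>J. g j)"
proof (rule ennreal_le_epsilon)
  fix e :: real
  assume fin: "(INF i\<in>I. f i) + (INF j\<in>J. g j) < top" and e: "0 < e"
  \<comment> \<open>Strictness fails at \<open>top\<close>; the infima are finite here because their
    sum is.\<close>
  have less: "y < y + ennreal (e/2)" if "y < top" for y
    using that e by (cases y rule: ennreal_cases) (simp_all add: ennreal_plus[symmetric] ennreal_less_iff del: ennreal_plus)
  have "(INF i\<in>I. f i) < (INF i\<in>I. f i) + ennreal (e/2)"
    "(INF j\<in>J. g j) < (INF j\<in>J. g j) + ennreal (e/2)"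
    using fin by (simp_all only: less ennreal_add_less_top)
  then obtain i j where "i \<in> I" "f i < (INF i\<in>I. f i) + ennreal (e/2)"
      "j \<in> J" "g j < (INF j\<in>J. g j) + ennreal (e/2)"
    unfolding INF_less_iff by blast
  then have "x \<le> ((INF i\<in>I. f i) + ennreal (e/2)) + ((INF j\<in>J. g j) + ennreal (e/2))"
    by (intro order_trans[OF assms add_mono]) auto
  also have "\<dots> = ((INF i\<in>I. f i) + (INF j\<in>J. g j)) + (ennreal (e/2) + ennreal (e/2))"
    by (simp add: ac_simps)
  also have "ennreal (e/2) + ennreal (e/2) = ennreal e"
    using e by (simp add: ennreal_plus[symmetric] del: ennreal_plus)
  finally show "x \<le> (INF i\<in>I. f i) + (INF j\<in>J. g j) + ennreal e" .
qed

text \<open>By concatenation inside the interior. The hypothesis on \<open>g\<close> is one that the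
  product metric satisfies although it may blow up at the boundary.\<close>

lemma interior_distance_triangle:
  fixes A :: "('m::{t2_space, second_countable_topology}, 'n::finite) corner_chart set"
  assumes man: "manifold_with_corners A"
    and g: "\<And>q v m. v \<in> tangent_space A q \<Longrightarrow>
      g q (\<lambda>c. m *\<^sub>R v c) (\<lambda>c. m *\<^sub>R v c) = m\<^sup>2 * g q v v"
  shows "interior_distance A g x z \<le> interior_distance A g x y + interior_distance A g y z"
proof -
  let ?C = "\<lambda>x y. {\<gamma>. piecewise_smooth_curve A \<gamma> \<and> \<gamma> ` {0..1} \<subseteq> mfd_interior A \<and> \<gamma> 0 = x \<and> \<gamma> 1 = y}"
  have join: "\<gamma>1 +++ \<gamma>2 \<in> ?C x z" if "\<gamma>1 \<in> ?C x y" "\<gamma>2 \<in> ?C y z" for \<gamma>1 \<gamma>2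
  proof -
    have "path_image (\<gamma>1 +++ \<gamma>2) \<subseteq> mfd_interior A"
      using that path_image_join_subset[of \<gamma>1 \<gamma>2] by (auto simp: path_image_def)
    then show ?thesis
      using that piecewise_smooth_curve_join[of A \<gamma>1 \<gamma>2]
      by (auto simp: path_image_def joinpaths_def)
  qed
  have *: "interior_distance A g x z \<le> ennreal (curve_length A g \<gamma>1) + ennreal (curve_length A g \<gamma>2)"
    if "\<gamma>1 \<in> ?C x y" "\<gamma>2 \<in> ?C y z" for \<gamma>1 \<gamma>2
  proof -
    have "interior_distance A g x z \<le> ennreal (curve_length A g (\<gamma>1 +++ \<gamma>2))"
      unfolding interior_distance_def by (intro INF_lower join that)
    also have "\<dots> \<le> ennreal (curve_length A g \<gamma>1) + ennreal (curve_length A g \<gamma>2)"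
      by (rule curve_length_join_le[OF man]) (use that g in auto)
    finally show ?thesis .
  qed
  show ?thesis
    unfolding interior_distance_def[of A g x y] interior_distance_def[of A g y z]
    by (intro le_INF_add_INF_ennreal *)
qed

section \<open>Local bounds near a boundary point\<close>

text \<open>A chart image is open only relative to the corner. A property holding eventually in
  \<open>nhds\<close>, guarded by membership in the corner, lets all local estimates be intersected
  and turned into one radius.\<close>

lemma eventually_chart_image:
  assumes "manifold_with_corners A" "c \<in> charts_at A p" "open W" "p \<in> W"
  shows "\<forall>\<^sub>F x in nhds (chart_map c p). x \<in> corner_model (chart_corner c) \<longrightarrow>
    x \<in> chart_map c ` chart_dom c \<and> chart_inv c x \<in> W"
proof -
  note man = assms(1) and cA = charts_atD(1)[OF assms(2)] and pc = charts_atD(2)[OF assms(2)]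
  let ?U = "chart_map c ` chart_dom c"
  obtain V where V: "open V" "?U = corner_model (chart_corner c) \<inter> V"
    using chart_image_openin[OF man cA] by (auto simp: openin_open)
  obtain V' where V': "open V'" "chart_inv c -` W \<inter> ?U = V' \<inter> ?U"
    using chart_inv_continuous[OF man cA] assms(3) by (auto simp: continuous_on_open_invariant)
  have "chart_map c p \<in> V \<inter> V'"
    using V(2) V'(2) pc assms(4) chart_inv_map[OF man cA pc] by auto
  moreover have "open (V \<inter> V')" using V V' by auto
  ultimately have "\<forall>\<^sub>F x in nhds (chart_map c p). x \<in> V \<inter> V'" by (intro eventually_nhds_in_open)
  then show ?thesis by (rule eventually_mono) (use V(2) V'(2) in blast)
qed

lemma eventually_nhds_within:
  assumes "continuous_on U f" "x0 \<in> U" "open V" "f x0 \<in> V"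
  shows "\<forall>\<^sub>F x in nhds x0. x \<in> U \<longrightarrow> f x \<in> V"
proof -
  have "(f \<longlongrightarrow> f x0) (at x0 within U)" using assms(1,2) by (simp add: continuous_on_def)
  then have "\<forall>\<^sub>F x in at x0 within U. f x \<in> V" using assms(3,4) by (rule topological_tendstoD)
  then show ?thesis using assms(4) unfolding eventually_at_filter by (auto elim: eventually_mono)
qed

text \<open>On the corner the defining function vanishes together with the \<open>k\<close>-th coordinate, so its
  nonzero differential is a positive multiple of \<open>dx\<^sub>k\<close>; the mean value theorem along the
  \<open>k\<close>-th coordinate then gives the bound.\<close>

lemma boundary_defining_function_lower_bound:
  fixes A :: "('m::{t2_space, second_countable_topology}, 'n::finite) corner_chart set"
  assumes man: "manifold_with_corners A" and c: "c \<in> charts_at A p" and pS: "p \<in> S"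
    and emb: "embedded_hypersurface A S" and bdf: "boundary_defining_function A S \<rho>"
  obtains k m where "k \<in> chart_corner c" "0 < m"
    "\<forall>\<^sub>F x in nhds (chart_map c p). x \<in> corner_model (chart_corner c) \<longrightarrow>
       m * x $ k \<le> \<rho> (chart_inv c x)"
proof -
  note cA = charts_atD(1)[OF c] and pc = charts_atD(2)[OF c]
  define K where "K = corner_model (chart_corner c)"
  define U where "U = chart_map c ` chart_dom c"
  define x0 where "x0 = chart_map c p"
  define f where "f = \<rho> \<circ> chart_inv c"
  \<comment> \<open>Embeddedness singles out one coordinate: near \<open>p\<close> the hypersurface
    is the wall \<open>x $ k = 0\<close>.\<close>
  obtain k W where k: "k \<in> chart_corner c" "x0 $ k = 0" and W: "open W" "p \<in> W"
    "S \<inter> W = {q\<in>W. chart_map c q $ k = 0}"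
    using emb pS c unfolding embedded_hypersurface_def vanishing_coords_def x0_def by fast
  have x0U: "x0 \<in> U" and UK: "U \<subseteq> K"
    using pc openin_imp_subset[OF chart_image_openin[OF man cA]] by (auto simp: U_def x0_def K_def)
  have x0K: "x0 \<in> K" using x0U UK by auto
  have f_nonneg: "0 \<le> f x" for x using bdf by (simp add: f_def boundary_defining_function_def)
  have "smooth_on U f"
    using bdf cA by (auto simp: boundary_defining_function_def smooth_function_def f_def U_def)
  then obtain O' F where O': "open O'" "x0 \<in> O'" and FC: "\<And>k. Ck_on k O' F"
    and Ff: "\<And>y. y \<in> U \<inter> O' \<Longrightarrow> F y = f y"
    and fD: "(f has_derivative frechet_derivative F (at x0)) (at x0 within U)"
    using x0U by (rule smooth_on_imp_has_derivative) (rule that)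
  \<comment> \<open>Working with the extension gives directional derivatives that are continuous on
    the full neighbourhood \<open>O'\<close> of \<open>x0\<close>.\<close>
  define F' where "F' x = frechet_derivative F (at x)" for x
  have FD: "(F has_derivative F' x) (at x)" if "x \<in> O'" for x
    using FC[of 1] that unfolding F'_def by (simp add: frechet_derivative_works[symmetric])
  have FD_line: "((\<lambda>t. F (x + t *\<^sub>R w)) has_real_derivative F' (x + t *\<^sub>R w) w) (at t)"
    if "x + t *\<^sub>R w \<in> O'" for x w t
  proof -
    have "((\<lambda>t. x + t *\<^sub>R w) has_derivative (\<lambda>h. h *\<^sub>R w)) (at t)"
      by (auto intro!: derivative_eq_intros)
    from has_derivative_compose[OF this FD[OF that]]
    show ?thesis
      using has_derivative_linear[OF FD[OF that]]
      by (simp add: has_field_derivative_def linear_scale mult_commute_abs)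
  qed
  have "\<forall>\<^sub>F x in nhds x0. (x \<in> K \<longrightarrow> x \<in> U \<and> chart_inv c x \<in> W) \<and> x \<in> O'"
    using eventually_chart_image[OF man c W(1,2)] eventually_nhds_in_open[OF O']
    unfolding K_def U_def x0_def by (rule eventually_conj)
  then obtain r where r: "r > 0"
    "\<And>x. dist x x0 < r \<Longrightarrow> (x \<in> K \<longrightarrow> x \<in> U \<and> chart_inv c x \<in> W) \<and> x \<in> O'"
    unfolding eventually_nhds_metric by blast
  have F_eq: "F x = f x" if "dist x x0 < r" "x \<in> K" for x
    using r(2)[OF that(1)] that(2) Ff by blast
  have F_zero: "F x = 0" if x: "dist x x0 < r" "x \<in> K" "x $ k = 0" for x
  proof -
    have "chart_inv c x \<in> W" "x \<in> U" using r(2)[OF x(1)] x(2) by auto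
    then have "chart_inv c x \<in> S \<inter> W"
      using x(3) W(3) chart_map_inv[OF man cA] by (auto simp: U_def)
    then have "f x = 0" using bdf by (auto simp: f_def boundary_defining_function_def)
    then show ?thesis using F_eq x by simp
  qed
  have axis_K: "x0 + t *\<^sub>R axis j 1 \<in> K" if "0 \<le> t" for t j
    using x0K that by (auto simp: K_def corner_model_def axis_def)
  have axis_dist: "dist (x0 + t *\<^sub>R axis j 1) x0 < r" if "\<bar>t\<bar> < r" for t j
    using that by (simp add: dist_norm)
  \<comment> \<open>Moving from \<open>x0\<close> along another axis stays in the wall, where
    \<open>F\<close> vanishes. Only nonnegative \<open>t\<close> are sure to stay in the corner, so
    the derivative is identified from one side.\<close>
  have zero: "F' x0 (axis j 1) = 0" if "j \<noteq> k" for j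
  proof -
    let ?\<phi> = "\<lambda>t. F (x0 + t *\<^sub>R axis j 1)"
    have "(?\<phi> has_vector_derivative F' x0 (axis j 1)) (at 0 within cbox 0 (r/2))"
      using FD_line[of x0 0 "axis j 1"] O'(2)
      by (simp add: has_real_derivative_iff_has_vector_derivative has_vector_derivative_at_within)
    moreover have "(?\<phi> has_vector_derivative 0) (at 0 within cbox 0 (r/2))"
    proof (rule has_vector_derivative_transform)
      show "(0::real) \<in> cbox 0 (r/2)" using r(1) by simp
      show "?\<phi> t = 0" if "t \<in> cbox 0 (r/2)" for t
        using that k(2) \<open>j \<noteq> k\<close> r(1) by (intro F_zero axis_dist axis_K) (auto simp: axis_def)
    qed (rule has_vector_derivative_const)
    ultimately show ?thesis
      using r(1) by (intro vector_derivative_unique_within_closed_interval[of 0 "r/2" 0 ?\<phi>]) auto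
  qed
  have "F' x0 (axis k 1) \<noteq> 0"
  proof
    assume "F' x0 (axis k 1) = 0"
    then have z: "F' x0 (axis j 1) = 0" for j using zero by (cases "j = k") auto
    obtain L v where "has_differential A \<rho> p L" "v \<in> tangent_space A p" "L v \<noteq> 0"
      using bdf pS unfolding boundary_defining_function_def by blast
    then obtain D where D: "(f has_derivative D) (at x0 within U)" "D (v c) \<noteq> 0"
      using c unfolding has_differential_def f_def x0_def U_def by metis
    have "F' x0 = D"
    \<comment> \<open>Derivatives within \<open>U\<close> are unique because from \<open>x0\<close>
      one can move inside \<open>U\<close> a short positive way along every axis.\<close>
    proof (rule frechet_derivative_unique_within[OF fD[folded F'_def] D(1)])
      fix i :: "real ^ 'n" and e :: real assume "i \<in> Basis" "0 < e"
      then obtain j where j: "i = axis j 1" by (auto simp: Basis_vec_def)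
      let ?d = "min e r / 2"
      have "x0 + ?d *\<^sub>R i \<in> U"
        using r \<open>0 < e\<close> axis_K[of ?d j] axis_dist[of ?d j] by (auto simp: j)
      then show "\<exists>d. 0 < \<bar>d\<bar> \<and> \<bar>d\<bar> < e \<and> x0 + d *\<^sub>R i \<in> U"
        using r(1) \<open>0 < e\<close> by (intro exI[of _ ?d]) auto
    qed
    moreover have "linear (F' x0)" using FD[OF O'(2)] by (rule has_derivative_linear)
    then have "F' x0 w = 0" for w
    proof -
      have "F' x0 (\<Sum>j\<in>UNIV. w $ j *s axis j 1) = (\<Sum>j\<in>UNIV. w $ j *\<^sub>R F' x0 (axis j 1))"
        using \<open>linear (F' x0)\<close> by (simp add: linear_sum linear_scale scalar_mult_eq_scaleR)
      then show ?thesis by (simp add: basis_expansion z)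
    qed
    ultimately show False using D(2) by simp
  qed
  \<comment> \<open>A negative value would make \<open>F\<close> negative just inside the corner,
    where it equals the nonnegative defining function.\<close>
  moreover have "\<not> F' x0 (axis k 1) < 0"
  proof
    assume neg: "F' x0 (axis k 1) < 0"
    have "((\<lambda>t. F (x0 + t *\<^sub>R axis k 1)) has_real_derivative F' x0 (axis k 1)) (at 0)"
      using FD_line[of x0 0 "axis k 1"] O'(2) by simp
    from DERIV_neg_dec_right[OF this neg]
    obtain d where d: "d > 0" "\<And>h. 0 < h \<Longrightarrow> h < d \<Longrightarrow> F (x0 + h *\<^sub>R axis k 1) < F x0" by auto
    let ?h = "min d r / 2"
    have "F (x0 + ?h *\<^sub>R axis k 1) = f (x0 + ?h *\<^sub>R axis k 1)"
      using d(1) r(1) by (intro F_eq axis_K axis_dist) auto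
    moreover have "F x0 = 0" using F_zero[of x0] r(1) x0K k(2) by simp
    moreover have "0 < ?h" "?h < d" using d(1) r(1) by (auto simp: min_def)
    ultimately show False using d(2)[of ?h] f_nonneg[of "x0 + ?h *\<^sub>R axis k 1"] by simp
  qed
  ultimately have pos: "0 < F' x0 (axis k 1)" by simp
  \<comment> \<open>Half of the derivative at \<open>x0\<close>, so that by continuity it remains a
    strict lower bound nearby.\<close>
  define m where "m = F' x0 (axis k 1) / 2"
  have m: "0 < m" "m < F' x0 (axis k 1)" using pos by (auto simp: m_def)
  have "continuous_on O' (\<lambda>x. F' x (axis k 1))" using FC[of 1] by (simp add: F'_def)
  from eventually_nhds_within[OF this O'(2) open_greaterThan, of m]
  have "\<forall>\<^sub>F x in nhds x0. x \<in> O' \<longrightarrow> m < F' x (axis k 1)" using m by simp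
  then obtain r' where r': "r' > 0" "\<And>x. dist x x0 < r' \<Longrightarrow> x \<in> O' \<Longrightarrow> m < F' x (axis k 1)"
    unfolding eventually_nhds_metric by blast
  \<comment> \<open>The foot \<open>y\<close> of \<open>x\<close> on the wall can be almost twice as
    far from \<open>x0\<close> as \<open>s\<close>; halving keeps the segment from \<open>y\<close>
    to \<open>x\<close> inside both radii.\<close>
  define s where "s = min r r' / 2"
  have s: "0 < s" "2 * s \<le> r" "2 * s \<le> r'" using r(1) r'(1) by (auto simp: s_def)
  have bound: "m * x $ k \<le> \<rho> (chart_inv c x)" if x: "dist x x0 < s" "x \<in> K" for x
  proof (cases "x $ k = 0")
    case True
    then show ?thesis using f_nonneg[of x] by (simp add: f_def)
  next
    case False
    then have xk: "0 < x $ k" using x(2) k(1) by (force simp: K_def corner_model_def)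
    define y where "y = x - (x $ k) *\<^sub>R axis k 1"
    have yK: "y \<in> K" using x(2) by (auto simp: y_def K_def corner_model_def axis_def)
    have yk: "y $ k = 0" by (simp add: y_def)
    have "\<bar>(x - x0) $ k\<bar> \<le> norm (x - x0)" by (rule component_le_norm_cart)
    then have "norm ((x $ k) *\<^sub>R axis k (1::real) :: real ^ 'n) < s"
      using x(1) k(2) xk by (simp add: dist_norm)
    then have "norm (y - x0) < 2 * s"
      using x(1) norm_triangle_ineq4[of "x - x0" "(x $ k) *\<^sub>R axis k 1"]
      by (simp add: y_def dist_norm algebra_simps)
    then have yd: "dist y x0 < 2 * s" by (simp add: dist_norm)
    have near: "dist (y + t *\<^sub>R axis k 1) x0 < 2 * s" if t: "0 \<le> t" "t \<le> x $ k" for t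
    proof -
      have "y + t *\<^sub>R axis k 1 = (1 - t / x $ k) *\<^sub>R y + (t / x $ k) *\<^sub>R x"
        using xk by (simp add: y_def algebra_simps)
      moreover have "\<dots> \<in> ball x0 (2 * s)"
        using yd x(1) s(1) t xk
        by (intro convexD[OF convex_ball]) (auto simp: dist_commute)
      ultimately show ?thesis by (simp add: dist_commute)
    qed
    have d: "((\<lambda>t. F (y + t *\<^sub>R axis k 1)) has_real_derivative F' (y + t *\<^sub>R axis k 1) (axis k 1)) (at t)"
      if "0 \<le> t" "t \<le> x $ k" for t
      using near[OF that] r(2) s by (intro FD_line) force
    obtain z where z: "0 < z" "z < x $ k"
      "F (y + (x $ k) *\<^sub>R axis k 1) - F (y + 0 *\<^sub>R axis k 1) =
        (x $ k - 0) * F' (y + z *\<^sub>R axis k 1) (axis k 1)"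
      using MVT2[OF xk d] by blast
    have "F y = 0" using yd s yK yk by (intro F_zero) auto
    moreover have "F x = f x" using x s by (intro F_eq) auto
    ultimately have "f x = x $ k * F' (y + z *\<^sub>R axis k 1) (axis k 1)"
      using z(3) by (simp add: y_def)
    moreover have "m \<le> F' (y + z *\<^sub>R axis k 1) (axis k 1)"
      using near[of z] z(1,2) r(2) s by (intro less_imp_le r'(2)) force+
    ultimately show ?thesis using xk by (simp add: f_def mult.commute)
  qed
  show ?thesis
  proof (rule that[OF k(1) m(1)])
    show "\<forall>\<^sub>F x in nhds (chart_map c p). x \<in> corner_model (chart_corner c) \<longrightarrow>
       m * x $ k \<le> \<rho> (chart_inv c x)"
      using bound s(1) unfolding eventually_nhds_metric x0_def[symmetric] K_def[symmetric] by blast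
  qed
qed

text \<open>For active \<open>i\<close> the defining function is at least a multiple of some corner
  coordinate, hence of \<open>s\<close>; for inactive \<open>i\<close> it is bounded away from 0.
  Taking \<open>s\<close> below all corner coordinates avoids tracking which coordinate belongs to
  which hypersurface.\<close>

lemma conformal_factor_bound:
  fixes A :: "('m::{t2_space, second_countable_topology}, 'n::finite) corner_chart set"
  assumes man: "manifold_with_corners A" and c: "c \<in> charts_at A p"
    and emb: "\<And>i. i \<in> {1..N} \<Longrightarrow> embedded_hypersurface A (H i)"
    and bdf: "\<And>i. i \<in> {1..N} \<Longrightarrow> boundary_defining_function A (H i) (\<rho> i)"
    and \<alpha>: "\<And>i. i \<in> {1..N} \<Longrightarrow> 0 \<le> \<alpha> i"
    and p: "p \<in> open_face H N I"
  obtains C where "0 < C" "\<forall>\<^sub>F x in nhds (chart_map c p). x \<in> corner_model (chart_corner c) \<longrightarrow>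
    (\<forall>s>0. (\<forall>k\<in>chart_corner c. s \<le> x $ k) \<longrightarrow>
      (\<Prod>i=1..N. \<rho> i (chart_inv c x) powr - \<alpha> i) \<le> C * s powr - (\<Sum>i\<in>I. \<alpha> i))"
proof -
  note cA = charts_atD(1)[OF c] and pc = charts_atD(2)[OF c]
  define K where "K = corner_model (chart_corner c)"
  define x0 where "x0 = chart_map c p"
  \<comment> \<open>Exponent 0 at inactive indices gives all factors a bound of the same shape, and
    the exponents sum to that of \<open>I\<close>.\<close>
  define \<beta> where "\<beta> i = (if i \<in> I then \<alpha> i else 0)" for i
  have "\<exists>C>0. \<forall>\<^sub>F x in nhds x0. x \<in> K \<longrightarrow>
    (\<forall>s>0. (\<forall>k\<in>chart_corner c. s \<le> x $ k) \<longrightarrow> \<rho> i (chart_inv c x) powr - \<alpha> i \<le> C * s powr - \<beta> i)"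
    if i: "i \<in> {1..N}" for i
  proof (cases "i \<in> I")
    case True
    then have "p \<in> H i" using p by (auto simp: open_face_def)
    obtain k m where k: "k \<in> chart_corner c" "0 < m"
      and ev: "\<forall>\<^sub>F x in nhds x0. x \<in> K \<longrightarrow> m * x $ k \<le> \<rho> i (chart_inv c x)"
      by (rule boundary_defining_function_lower_bound[OF man c \<open>p \<in> H i\<close> emb[OF i] bdf[OF i]])
        (rule that[unfolded K_def x0_def])
    have "\<rho> i (chart_inv c x) powr - \<alpha> i \<le> m powr - \<alpha> i * s powr - \<beta> i"
      if x: "m * x $ k \<le> \<rho> i (chart_inv c x)" "0 < s" "s \<le> x $ k" for x s
    proof -
      have "m * s \<le> \<rho> i (chart_inv c x)"
        using x(1) mult_left_mono[OF x(3) less_imp_le[OF k(2)]] by (rule order_trans[rotated])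
      then have "\<rho> i (chart_inv c x) powr - \<alpha> i \<le> (m * s) powr - \<alpha> i"
        using \<alpha>[OF i] k(2) x(2) by (intro powr_mono2') auto
      then show ?thesis using k(2) x(2) True by (simp add: powr_mult \<beta>_def)
    qed
    with ev k show ?thesis
      by (intro exI[of _ "m powr - \<alpha> i"]) (auto elim!: eventually_mono)
  next
    case False
    have "0 < \<rho> i p"
      using False p i bdf[OF i] unfolding boundary_defining_function_def open_face_def
      by (metis (mono_tags, lifting) mem_Collect_eq order_le_imp_less_or_eq)
    define m where "m = \<rho> i p / 2"
    have m: "0 < m" "m < \<rho> i p" using \<open>0 < \<rho> i p\<close> by (auto simp: m_def)
    have "continuous_on (chart_map c ` chart_dom c) (\<rho> i \<circ> chart_inv c)"
      using bdf[OF i] cA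
      by (intro smooth_on_imp_continuous_on) (auto simp: boundary_defining_function_def smooth_function_def)
    then have "\<forall>\<^sub>F x in nhds x0. x \<in> chart_map c ` chart_dom c \<longrightarrow> (\<rho> i \<circ> chart_inv c) x \<in> {m<..}"
      using pc m chart_inv_map[OF man cA pc] unfolding x0_def
      by (intro eventually_nhds_within) auto
    with eventually_chart_image[OF man c open_UNIV UNIV_I]
    have "\<forall>\<^sub>F x in nhds x0. x \<in> K \<longrightarrow> m < \<rho> i (chart_inv c x)"
      unfolding K_def x0_def by (auto elim: eventually_elim2)
    moreover have "\<rho> i (chart_inv c x) powr - \<alpha> i \<le> m powr - \<alpha> i * s powr - \<beta> i"
      if "m < \<rho> i (chart_inv c x)" "0 < s" for x s
      using that False m \<alpha>[OF i] by (auto simp: \<beta>_def intro!: powr_mono2')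
    ultimately show ?thesis using m
      by (intro exI[of _ "m powr - \<alpha> i"]) (auto elim!: eventually_mono)
  qed
  then have "\<exists>C. \<forall>i\<in>{1..N}. 0 < C i \<and> (\<forall>\<^sub>F x in nhds x0. x \<in> K \<longrightarrow>
      (\<forall>s>0. (\<forall>k\<in>chart_corner c. s \<le> x $ k) \<longrightarrow> \<rho> i (chart_inv c x) powr - \<alpha> i \<le> C i * s powr - \<beta> i))"
    by (intro bchoice ballI)
  then obtain C where "\<forall>i\<in>{1..N}. 0 < C i \<and> (\<forall>\<^sub>F x in nhds x0. x \<in> K \<longrightarrow>
      (\<forall>s>0. (\<forall>k\<in>chart_corner c. s \<le> x $ k) \<longrightarrow> \<rho> i (chart_inv c x) powr - \<alpha> i \<le> C i * s powr - \<beta> i))"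
    by (elim exE)
  note C = bspec[OF this, THEN conjunct1] bspec[OF this, THEN conjunct2]
  have I: "I = {i\<in>{1..N}. i \<in> I}" using p by (auto simp: open_face_def)
  have "(\<Sum>i=1..N. \<beta> i) = (\<Sum>i\<in>I. \<alpha> i)"
    unfolding \<beta>_def by (subst sum.inter_filter[symmetric]) (use I in auto)
  then have prod: "(\<Prod>i=1..N. C i * s powr - \<beta> i) = (\<Prod>i=1..N. C i) * s powr - (\<Sum>i\<in>I. \<alpha> i)"
    if "0 < s" for s
    using that by (simp add: prod.distrib powr_sum[symmetric] sum_negf)
  have "\<forall>\<^sub>F x in nhds x0. \<forall>i\<in>{1..N}. x \<in> K \<longrightarrow>
      (\<forall>s>0. (\<forall>k\<in>chart_corner c. s \<le> x $ k) \<longrightarrow> \<rho> i (chart_inv c x) powr - \<alpha> i \<le> C i * s powr - \<beta> i)"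
    using C(2) by (intro eventually_ball_finite) auto
  then have "\<forall>\<^sub>F x in nhds x0. x \<in> K \<longrightarrow> (\<forall>s>0. (\<forall>k\<in>chart_corner c. s \<le> x $ k) \<longrightarrow>
      (\<Prod>i=1..N. \<rho> i (chart_inv c x) powr - \<alpha> i) \<le> (\<Prod>i=1..N. C i) * s powr - (\<Sum>i\<in>I. \<alpha> i))"
  proof (rule eventually_mono, intro impI allI)
    fix x and s :: real
    assume *: "\<forall>i\<in>{1..N}. x \<in> K \<longrightarrow> (\<forall>s>0. (\<forall>k\<in>chart_corner c. s \<le> x $ k) \<longrightarrow>
        \<rho> i (chart_inv c x) powr - \<alpha> i \<le> C i * s powr - \<beta> i)"
      and x: "x \<in> K" and s: "0 < s" and le: "\<forall>k\<in>chart_corner c. s \<le> x $ k"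
    have "(\<Prod>i=1..N. \<rho> i (chart_inv c x) powr - \<alpha> i) \<le> (\<Prod>i=1..N. C i * s powr - \<beta> i)"
      using * x s le by (intro prod_mono) auto
    then show "(\<Prod>i=1..N. \<rho> i (chart_inv c x) powr - \<alpha> i) \<le>
        (\<Prod>i=1..N. C i) * s powr - (\<Sum>i\<in>I. \<alpha> i)"
      using prod[OF s] by simp
  qed
  then show ?thesis
    using C(1) by (intro that[of "\<Prod>i=1..N. C i"] prod_pos) (auto simp: K_def x0_def)
qed

text \<open>Cauchy-Schwarz together with local boundedness of the continuous coefficient matrix;
  \<open>b\<close> is a bound for matrix-vector multiplication as a bilinear map.\<close>

lemma riemannian_metric_upper_bound:
  fixes A :: "('m::{t2_space, second_countable_topology}, 'n::finite) corner_chart set"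
  assumes man: "manifold_with_corners A" and c: "c \<in> charts_at A p" and g: "riemannian_metric A g"
  obtains M where "0 < M" "\<forall>\<^sub>F x in nhds (chart_map c p). x \<in> corner_model (chart_corner c) \<longrightarrow>
    (\<forall>v\<in>tangent_space A (chart_inv c x). g (chart_inv c x) v v \<le> M * (norm (v c))\<^sup>2)"
proof -
  note cA = charts_atD(1)[OF c] and pc = charts_atD(2)[OF c]
  let ?U = "chart_map c ` chart_dom c"
  obtain G where G: "smooth_on ?U G" "\<And>q v w. \<lbrakk>q \<in> chart_dom c; v \<in> tangent_space A q;
      w \<in> tangent_space A q\<rbrakk> \<Longrightarrow> g q v w = v c \<bullet> (G (chart_map c q) *v w c)"
    using g cA unfolding riemannian_metric_def by metis
  have "bilinear (\<lambda>(B::real^'n^'n) (x::real^'n). B *v x)"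
    by (auto simp: bilinear_def linear_iff matrix_vector_mult_add_rdistrib matrix_vector_right_distrib
        scaleR_matrix_vector_assoc matrix_vector_mult_scaleR)
  then obtain b where b: "b > 0" "\<And>(B::real^'n^'n) (x::real^'n). norm (B *v x) \<le> norm B * norm x * b"
    using bounded_bilinear.pos_bounded[OF bilinear_conv_bounded_bilinear[THEN iffD1]] by metis
  define m where "m = norm (G (chart_map c p)) + 1"
  have m: "0 < m" by (simp add: m_def add_nonneg_pos)
  have "\<forall>\<^sub>F x in nhds (chart_map c p). x \<in> ?U \<longrightarrow> norm (G x) \<in> {..<m}"
    using pc smooth_on_imp_continuous_on[OF G(1)]
    by (intro eventually_nhds_within continuous_on_norm) (auto simp: m_def)
  with eventually_chart_image[OF man c open_UNIV UNIV_I]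
  have ev: "\<forall>\<^sub>F x in nhds (chart_map c p). x \<in> corner_model (chart_corner c) \<longrightarrow>
      x \<in> ?U \<and> norm (G x) < m"
    by (auto elim: eventually_elim2)
  have "g (chart_inv c x) v v \<le> (m * b) * (norm (v c))\<^sup>2"
    if x: "x \<in> ?U" "norm (G x) < m" and v: "v \<in> tangent_space A (chart_inv c x)" for x v
  proof -
    have "g (chart_inv c x) v v = v c \<bullet> (G x *v v c)"
      using G(2)[OF chart_inv_dom[OF man cA x(1)] v v] chart_map_inv[OF man cA x(1)] by simp
    also have "\<dots> \<le> norm (v c) * norm (G x *v v c)" by (rule norm_cauchy_schwarz)
    also have "\<dots> \<le> norm (v c) * (norm (G x) * norm (v c) * b)"
      by (intro mult_left_mono b) auto
    also have "\<dots> = norm (G x) * (norm (v c) * norm (v c) * b)" by (simp add: ac_simps)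
    also have "\<dots> \<le> m * (norm (v c) * norm (v c) * b)"
      using x(2) b(1) by (intro mult_right_mono) auto
    finally show ?thesis by (simp add: power2_eq_square ac_simps)
  qed
  then show ?thesis
    using m b(1) by (intro that[of "m * b"] eventually_mono[OF ev]) auto
qed

text \<open>Discharges the homogeneity hypothesis of the triangle inequality. The bilinearity of
  \<open>g\<close> is read off its local matrix expression.\<close>

lemma product_metric_scaleR:
  fixes A :: "('m::{t2_space, second_countable_topology}, 'n::finite) corner_chart set"
  assumes "manifold_with_corners A" "riemannian_metric A g" "v \<in> tangent_space A q"
  shows "product_metric \<rho> \<alpha> N g q (\<lambda>c. m *\<^sub>R v c) (\<lambda>c. m *\<^sub>R v c) = m\<^sup>2 * product_metric \<rho> \<alpha> N g q v v"
proof -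
  obtain c where c: "c \<in> charts_at A q" using charts_at_nonempty[OF assms(1)] .
  obtain G where G: "\<And>q v w. \<lbrakk>q \<in> chart_dom c; v \<in> tangent_space A q;
      w \<in> tangent_space A q\<rbrakk> \<Longrightarrow> g q v w = v c \<bullet> (G (chart_map c q) *v w c)"
    using assms(2) charts_atD(1)[OF c] unfolding riemannian_metric_def by metis
  have "g q (\<lambda>c. m *\<^sub>R v c) (\<lambda>c. m *\<^sub>R v c) = m\<^sup>2 * g q v v"
    using G[OF charts_atD(2)[OF c]] assms(3) tangent_space_scaleR[OF assms(3)]
    by (simp add: matrix_vector_mult_scaleR power2_eq_square)
  then show ?thesis by (simp add: product_metric_def)
qed

section \<open>Short curves near a boundary point\<close>

text \<open>Transfers a coordinate curve to the manifold. In any other chart it is the transition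
  map composed with \<open>L\<close>, hence smooth; positive corner coordinates keep it in the
  interior.\<close>

lemma chart_curve:
  fixes A :: "('m::{t2_space, second_countable_topology}, 'n::finite) corner_chart set"
  assumes man: "manifold_with_corners A" and cA: "c \<in> A"
    and L: "\<And>k. Ck_on k UNIV L" "\<And>t. (L has_vector_derivative L' t) (at t)"
    and LU: "\<And>t. t \<in> {0..1} \<Longrightarrow> L t \<in> chart_map c ` chart_dom c"
    and pos: "\<And>t k. t \<in> {0..1} \<Longrightarrow> k \<in> chart_corner c \<Longrightarrow> 0 < L t $ k"
  defines "\<gamma> \<equiv> chart_inv c \<circ> L"
  shows "piecewise_smooth_curve A \<gamma>" "\<gamma> ` {0..1} \<subseteq> mfd_interior A"
    and "\<exists>T. finite T \<and> (\<forall>t\<in>{0<..<1} - T. velocity A \<gamma> t \<in> tangent_space A (\<gamma> t) \<and> velocity A \<gamma> t c = L' t)"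
proof -
  have dom: "\<gamma> t \<in> chart_dom c" and map: "chart_map c (\<gamma> t) = L t" if "t \<in> {0..1}" for t
    using LU[OF that] chart_inv_dom[OF man cA] chart_map_inv[OF man cA] by (auto simp: \<gamma>_def)
  show "\<gamma> ` {0..1} \<subseteq> mfd_interior A"
    using dom map pos cA by (auto intro!: coord_pos_imp_mfd_interior[OF man, of c] simp: charts_at_def)
  have "continuous_on {0..1} L" using Ck_on_subset[OF L(1)[of 0]] by simp
  then have cont: "continuous_on {0..1} \<gamma>"
    unfolding \<gamma>_def using LU
    by (intro continuous_on_compose continuous_on_subset[OF chart_inv_continuous[OF man cA]]) auto
  have smooth: "smooth_on {s\<in>{0..1}. \<gamma> s \<in> chart_dom d} (chart_map d \<circ> \<gamma>)" if "d \<in> A" for d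
  proof (rule smooth_on_compose[OF _ L(1)])
    show "smooth_on (chart_map c ` (chart_dom c \<inter> chart_dom d)) (chart_map d \<circ> chart_inv c)"
      using man cA that by (auto simp: manifold_with_corners_def)
    show "L ` {s \<in> {0..1}. \<gamma> s \<in> chart_dom d} \<subseteq> chart_map c ` (chart_dom c \<inter> chart_dom d)"
    proof (rule image_subsetI)
      fix t assume t: "t \<in> {s \<in> {0..1}. \<gamma> s \<in> chart_dom d}"
      then have "chart_map c (\<gamma> t) = L t" "\<gamma> t \<in> chart_dom c \<inter> chart_dom d" using dom map by auto
      then show "L t \<in> chart_map c ` (chart_dom c \<inter> chart_dom d)" by (metis imageI)
    qed
  qed (simp add: \<gamma>_def)
  show ps: "piecewise_smooth_curve A \<gamma>"
    unfolding piecewise_smooth_curve_def using cont smooth by (intro conjI exI[of _ "{0, 1}"]) auto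
  obtain T where T: "finite T"
    "\<And>t c. \<lbrakk>t \<in> {0<..<1} - T; c \<in> charts_at A (\<gamma> t)\<rbrakk> \<Longrightarrow> (chart_map c \<circ> \<gamma>) differentiable (at t)"
    using piecewise_smooth_curve_differentiable[OF man ps] by metis
  have "velocity A \<gamma> t \<in> tangent_space A (\<gamma> t) \<and> velocity A \<gamma> t c = L' t" if t: "t \<in> {0<..<1} - T" for t
  proof
    have t01: "t \<in> {0<..<1}" using t by simp
    show "velocity A \<gamma> t \<in> tangent_space A (\<gamma> t)"
      by (rule velocity_in_tangent_space[OF man cont t01 T(2)[OF t]])
    have "c \<in> charts_at A (\<gamma> t)" using dom[of t] t01 cA by (simp add: charts_at_def)
    then have "((chart_map c \<circ> \<gamma>) has_vector_derivative velocity A \<gamma> t c) (at t)"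
      using velocity_in_tangent_space(2)[OF man cont t01 T(2)[OF t]] by simp
    then have "(L has_vector_derivative velocity A \<gamma> t c) (at t)"
      using map by (elim has_vector_derivative_transform_within_open[OF _ open_greaterThanLessThan t01]) auto
    then show "velocity A \<gamma> t c = L' t" using L(2) vector_derivative_unique_at by blast
  qed
  with T(1) show "\<exists>T. finite T \<and> (\<forall>t\<in>{0<..<1} - T. velocity A \<gamma> t \<in> tangent_space A (\<gamma> t) \<and>
      velocity A \<gamma> t c = L' t)" by blast
qed

text \<open>Comparison with an integrable majorant. If the speed is not integrable, the length is 0
  by convention, which \<open>0 \<le> J\<close> covers.\<close>

lemma curve_length_le:
  assumes "finite T" "\<And>t. t \<in> {0<..<1} - T \<Longrightarrow> sqrt (g (\<gamma> t) (velocity A \<gamma> t) (velocity A \<gamma> t)) \<le> h t"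
    and h: "(h has_integral J) {0..1}" and "0 \<le> J"
  shows "curve_length A g \<gamma> \<le> J"
proof -
  define f where "f t = sqrt (g (\<gamma> t) (velocity A \<gamma> t) (velocity A \<gamma> t))" for t
  have len: "curve_length A g \<gamma> = integral {0..1} f" by (simp add: curve_length_def f_def[abs_def])
  show ?thesis
  proof (cases "f integrable_on {0..1}")
    case False
    then show ?thesis using \<open>0 \<le> J\<close> by (simp add: len not_integrable_integral)
  next
    case True
    \<comment> \<open>At the exceptional times the speed is replaced by \<open>h\<close> itself;
      this leaves the integral alone and makes the comparison hold everywhere.\<close>
    let ?T = "T \<union> {0, 1}" and ?f = "\<lambda>t. if t \<in> T \<union> {0, 1} then h t else f t"
    have "(?f has_integral integral {0..1} f) {0..1}"
      using assms(1) by (intro has_integral_spike_finite[OF _ _ integrable_integral[OF True], of ?T]) auto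
    then show ?thesis unfolding len
      by (rule has_integral_le[OF _ h]) (use assms(2) in \<open>auto simp: f_def\<close>)
  qed
qed

lemma nearby_points_short_distance:
  fixes A :: "('m::{t2_space, second_countable_topology}, 'n::finite) corner_chart set"
  assumes man: "manifold_with_corners A" and c: "c \<in> charts_at A p"
    and emb: "\<And>i. i \<in> {1..N} \<Longrightarrow> embedded_hypersurface A (H i)"
    and bdf: "\<And>i. i \<in> {1..N} \<Longrightarrow> boundary_defining_function A (H i) (\<rho> i)"
    and g0: "riemannian_metric A g0"
    and \<alpha>: "\<And>i. i \<in> {1..N} \<Longrightarrow> 0 \<le> \<alpha> i"
    and p: "p \<in> open_face H N I" and less2: "(\<Sum>i\<in>I. \<alpha> i) < 2" and e: "0 < (e :: ennreal)"
  obtains W where "open W" "p \<in> W"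
    "\<And>q q'. \<lbrakk>q \<in> W \<inter> mfd_interior A; q' \<in> W \<inter> mfd_interior A\<rbrakk> \<Longrightarrow>
      interior_distance A (product_metric \<rho> \<alpha> N g0) q q' < e"
proof -
  note cA = charts_atD(1)[OF c] and pc = charts_atD(2)[OF c]
  define K where "K = corner_model (chart_corner c)"
  define U where "U = chart_map c ` chart_dom c"
  define x0 where "x0 = chart_map c p"
  let ?g = "product_metric \<rho> \<alpha> N g0"
  obtain C where C: "0 < C" and evC: "\<forall>\<^sub>F x in nhds x0. x \<in> K \<longrightarrow>
    (\<forall>s>0. (\<forall>k\<in>chart_corner c. s \<le> x $ k) \<longrightarrow>
      (\<Prod>i=1..N. \<rho> i (chart_inv c x) powr - \<alpha> i) \<le> C * s powr - (\<Sum>i\<in>I. \<alpha> i))"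
    by (rule conformal_factor_bound[OF man c _ _ _ p, where \<rho> = \<rho> and \<alpha> = \<alpha>])
      ((rule emb bdf \<alpha> that[unfolded K_def x0_def]; assumption)+)
  obtain M where M: "0 < M" and evM: "\<forall>\<^sub>F x in nhds x0. x \<in> K \<longrightarrow>
    (\<forall>v\<in>tangent_space A (chart_inv c x). g0 (chart_inv c x) v v \<le> M * (norm (v c))\<^sup>2)"
    by (rule riemannian_metric_upper_bound[OF man c g0]) (rule that[unfolded K_def x0_def])
  have evU: "\<forall>\<^sub>F x in nhds x0. x \<in> K \<longrightarrow> x \<in> U \<and> chart_inv c x \<in> UNIV"
    using eventually_chart_image[OF man c open_UNIV UNIV_I] by (simp add: K_def U_def x0_def)
  obtain r where r: "0 < r"
    and rC: "\<And>x s. \<lbrakk>dist x x0 < r; x \<in> K; 0 < s; \<And>k. k \<in> chart_corner c \<Longrightarrow> s \<le> x $ k\<rbrakk> \<Longrightarrow>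
      (\<Prod>i=1..N. \<rho> i (chart_inv c x) powr - \<alpha> i) \<le> C * s powr - (\<Sum>i\<in>I. \<alpha> i)"
    and rM: "\<And>x v. \<lbrakk>dist x x0 < r; x \<in> K; v \<in> tangent_space A (chart_inv c x)\<rbrakk> \<Longrightarrow>
      g0 (chart_inv c x) v v \<le> M * (norm (v c))\<^sup>2"
    and rU: "\<And>x. \<lbrakk>dist x x0 < r; x \<in> K\<rbrakk> \<Longrightarrow> x \<in> U"
    using eventually_conj[OF evC eventually_conj[OF evM evU]] unfolding eventually_nhds_metric
    by (elim exE conjE) simp
  define a where "a = (\<Sum>i\<in>I. \<alpha> i) / 2"
  have "0 \<le> (\<Sum>i\<in>I. \<alpha> i)" using p \<alpha> by (intro sum_nonneg) (auto simp: open_face_def)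
  then have a: "0 \<le> a" "a < 1" "(\<Sum>i\<in>I. \<alpha> i) = 2 * a" using less2 by (auto simp: a_def)
  define o1 :: "real ^ 'n" where "o1 = vec 1"
  define b where "b = norm o1"
  have b: "0 \<le> b" by (simp add: b_def)
  \<comment> \<open>\<open>sqrt (C * M)\<close> comes from the bound on the metric,
    \<open>2 + b\<close> from the bound on the Euclidean speed: at most 2\<epsilon> from
    \<open>y - x\<close> and \<epsilon> \<open>b\<close> from the push.\<close>
  define B where "B = sqrt (C * M) * (2 + b)"
  define J where "J = Beta (1 - a) (1 - a)"
  have B: "0 \<le> B" using C M b by (simp add: B_def)
  have Beta: "((\<lambda>t. t powr - a * (1 - t) powr - a) has_integral J) {0..1}"
    using has_integral_Beta_real[of "1 - a" "1 - a"] a by (simp add: J_def)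
  have J: "0 \<le> J" by (rule has_integral_nonneg[OF Beta]) auto
  \<comment> \<open>\<open>e\<close> may be infinite, and then any positive real serves.\<close>
  obtain e' where e': "0 < e'" "ennreal e' \<le> e"
    using e by (cases e rule: ennreal_cases) (auto intro: that[of 1])
  \<comment> \<open>Chosen so that its power with exponent \<open>1 - a\<close> is the fraction
    inside; the added 1 keeps the denominator positive, as \<open>B * J\<close> is only known to be
    nonnegative.\<close>
  define \<epsilon>0 where "\<epsilon>0 = (e' / (2 * (B * J + 1))) powr (1 / (1 - a))"
  have BJ: "0 \<le> B * J" using B J by simp
  have \<epsilon>0: "0 < \<epsilon>0" using e'(1) BJ by (simp add: \<epsilon>0_def)
  \<comment> \<open>The second entry keeps the curve within \<open>r\<close> of \<open>x0\<close>: a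
    segment point is within \<epsilon>, and the push adds at most \<epsilon>
    \<open>b\<close>.\<close>
  define \<epsilon> where "\<epsilon> = min \<epsilon>0 (r / (2 * (1 + b)))"
  have \<epsilon>: "0 < \<epsilon>" "\<epsilon> \<le> \<epsilon>0" using \<epsilon>0 r b by (auto simp: \<epsilon>_def)
  have "\<epsilon> * (1 + b) \<le> r / (2 * (1 + b)) * (1 + b)"
    using b by (intro mult_right_mono) (auto simp: \<epsilon>_def)
  also have "\<dots> < r" using r b by (simp add: field_simps add_pos_nonneg)
  finally have \<epsilon>r: "\<epsilon> * (1 + b) < r" .
  have "\<epsilon> powr (1 - a) \<le> \<epsilon>0 powr (1 - a)" using \<epsilon> a by (intro powr_mono2) auto
  also have "\<dots> = e' / (2 * (B * J + 1))" using a e'(1) BJ by (simp add: \<epsilon>0_def powr_powr)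
  finally have "B * J * \<epsilon> powr (1 - a) \<le> B * J * (e' / (2 * (B * J + 1)))"
    using BJ by (rule mult_left_mono)
  also have "\<dots> < e'" using BJ e'(1) by (simp add: divide_simps)
  finally have small: "B * J * \<epsilon> powr (1 - a) < e'" .
  define W where "W = chart_dom c \<inter> chart_map c -` ball x0 \<epsilon>"
  show ?thesis
  proof (rule that)
    show "open W" unfolding W_def
      by (intro continuous_open_preimage chart_map_continuous[OF man cA] chart_dom_open[OF man cA]) auto
    show "p \<in> W" using pc \<epsilon>(1) by (simp add: W_def x0_def)
    fix q q' assume q: "q \<in> W \<inter> mfd_interior A" and q': "q' \<in> W \<inter> mfd_interior A"
    define x where "x = chart_map c q"
    define y where "y = chart_map c q'"
    have x: "dist x x0 < \<epsilon>" "\<And>k. k \<in> chart_corner c \<Longrightarrow> 0 < x $ k" "chart_inv c x = q"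
      using q cA chart_inv_map[OF man cA]
      by (auto simp: x_def W_def dist_commute charts_at_def intro!: mfd_interior_coord_pos[OF man])
    have y: "dist y x0 < \<epsilon>" "\<And>k. k \<in> chart_corner c \<Longrightarrow> 0 < y $ k" "chart_inv c y = q'"
      using q' cA chart_inv_map[OF man cA]
      by (auto simp: y_def W_def dist_commute charts_at_def intro!: mfd_interior_coord_pos[OF man])
    define L where "L t = x + t *\<^sub>R (y - x) + (\<epsilon> * (t * (1 - t))) *\<^sub>R o1" for t
    define L' where "L' t = (y - x) + (\<epsilon> * (1 - 2 * t)) *\<^sub>R o1" for t
    have L_nth: "L t $ k = (1 - t) * x $ k + t * y $ k + \<epsilon> * (t * (1 - t))" for t k
      by (simp add: L_def o1_def algebra_simps)
    have CkL: "Ck_on k UNIV L" for k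
    proof -
      have "Ck_on k UNIV (\<lambda>t. x + t *\<^sub>R (y - x) + t *\<^sub>R ((-\<epsilon> * t + \<epsilon>) *\<^sub>R o1))"
        by (intro Ck_on_add Ck_on_const Ck_on_scaleR Ck_on_affine
            Ck_on_bounded_linear[OF bounded_linear_ident]) auto
      moreover have "L = (\<lambda>t. x + t *\<^sub>R (y - x) + t *\<^sub>R ((-\<epsilon> * t + \<epsilon>) *\<^sub>R o1))"
        by (rule ext) (simp add: L_def algebra_simps)
      ultimately show ?thesis by simp
    qed
    have DL: "(L has_vector_derivative L' t) (at t)" for t
      unfolding L_def[abs_def] L'_def has_vector_derivative_def
      by (auto intro!: derivative_eq_intros simp: algebra_simps)
    \<comment> \<open>Interior end points have positive corner coordinates, so the affine part is
      positive and the push alone bounds each coordinate from below.\<close>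
    have posL: "0 < L t $ k" and lowL: "\<epsilon> * (t * (1 - t)) \<le> L t $ k"
      if "t \<in> {0..1}" "k \<in> chart_corner c" for t k
    proof -
      have "0 < (1 - t) * x $ k + t * y $ k"
        using that x(2)[of k] y(2)[of k] by (cases "t = 0") (auto intro: add_nonneg_pos)
      moreover have "0 \<le> \<epsilon> * (t * (1 - t))" using that \<epsilon>(1) by simp
      ultimately show "0 < L t $ k" "\<epsilon> * (t * (1 - t)) \<le> L t $ k" by (auto simp: L_nth)
    qed
    have LK: "L t \<in> K" if "t \<in> {0..1}" for t
      using posL[OF that] by (auto simp: K_def corner_model_def less_imp_le)
    have Lr: "dist (L t) x0 < r" if t: "t \<in> {0..1}" for t
    proof -
      have "(1 - t) *\<^sub>R x + t *\<^sub>R y \<in> ball x0 \<epsilon>"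
        using t x(1) y(1) by (intro convexD[OF convex_ball]) (auto simp: dist_commute)
      then have 1: "norm ((1 - t) *\<^sub>R x + t *\<^sub>R y - x0) < \<epsilon>" by (simp add: dist_norm norm_minus_commute)
      have "t * (1 - t) \<le> 1 * 1" using t by (intro mult_mono) auto
      then have "\<epsilon> * (t * (1 - t)) * b \<le> \<epsilon> * 1 * b"
        using \<epsilon>(1) b by (intro mult_right_mono mult_left_mono) auto
      then have 2: "norm ((\<epsilon> * (t * (1 - t))) *\<^sub>R o1) \<le> \<epsilon> * b"
        using t \<epsilon>(1) by (simp add: b_def abs_mult)
      have "L t - x0 = ((1 - t) *\<^sub>R x + t *\<^sub>R y - x0) + (\<epsilon> * (t * (1 - t))) *\<^sub>R o1"
        by (simp add: L_def algebra_simps)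
      then have "norm (L t - x0) \<le>
          norm ((1 - t) *\<^sub>R x + t *\<^sub>R y - x0) + norm ((\<epsilon> * (t * (1 - t))) *\<^sub>R o1)"
        by (simp only: norm_triangle_ineq)
      then have "norm (L t - x0) < \<epsilon> + \<epsilon> * b" using 1 2 by linarith
      then show ?thesis using \<epsilon>r by (simp add: dist_norm algebra_simps)
    qed
    have L'_norm: "norm (L' t) \<le> (2 + b) * \<epsilon>" if t: "t \<in> {0..1}" for t
    proof -
      have "norm (y - x) \<le> 2 * \<epsilon>"
        using x(1) y(1) dist_triangle2[of y x x0] by (simp add: dist_norm)
      moreover have "\<epsilon> * \<bar>1 - 2 * t\<bar> * b \<le> \<epsilon> * 1 * b"
        using t \<epsilon>(1) b by (intro mult_right_mono mult_left_mono) auto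
      then have "norm ((\<epsilon> * (1 - 2 * t)) *\<^sub>R o1) \<le> \<epsilon> * b"
        using \<epsilon>(1) by (simp add: b_def abs_mult)
      ultimately have "norm (L' t) \<le> 2 * \<epsilon> + \<epsilon> * b"
        unfolding L'_def by (rule norm_triangle_mono)
      then show ?thesis by (simp add: algebra_simps)
    qed
    define \<gamma> where "\<gamma> = chart_inv c \<circ> L"
    have LU: "L t \<in> chart_map c ` chart_dom c" if "t \<in> {0..1}" for t
      using rU[OF Lr LK] that by (simp add: U_def)
    note curve = chart_curve[OF man cA CkL DL LU posL, folded \<gamma>_def]
    obtain T where T: "finite T" "\<And>t. t \<in> {0<..<1} - T \<Longrightarrow> velocity A \<gamma> t \<in> tangent_space A (\<gamma> t)"
      "\<And>t. t \<in> {0<..<1} - T \<Longrightarrow> velocity A \<gamma> t c = L' t"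
      using curve(3) by blast
    have "curve_length A ?g \<gamma> \<le> B * \<epsilon> powr (1 - a) * J"
    proof (rule curve_length_le[OF T(1)])
      show "((\<lambda>t. B * \<epsilon> powr (1 - a) * (t powr - a * (1 - t) powr - a)) has_integral
          B * \<epsilon> powr (1 - a) * J) {0..1}"
        by (rule has_integral_mult_right[OF Beta])
      show "0 \<le> B * \<epsilon> powr (1 - a) * J" using B J by simp
      fix t assume t: "t \<in> {0<..<1} - T"
      then have t01: "t \<in> {0..1}" by auto
      define s where "s = \<epsilon> * (t * (1 - t))"
      have s: "0 < s" using t \<epsilon>(1) by (simp add: s_def)
      define P where "P = (\<Prod>i=1..N. \<rho> i (\<gamma> t) powr - \<alpha> i)"
      have P: "0 \<le> P" "P \<le> C * s powr - (2 * a)"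
        using rC[OF Lr[OF t01] LK[OF t01] s] lowL[OF t01]
        by (auto simp: P_def \<gamma>_def s_def a(3) intro!: prod_nonneg)
      let ?v = "velocity A \<gamma> t"
      have "g0 (\<gamma> t) ?v ?v \<le> M * (norm (L' t))\<^sup>2"
        using rM[OF Lr[OF t01] LK[OF t01], of ?v] T(2,3)[OF t] by (simp add: \<gamma>_def)
      also have "\<dots> \<le> M * ((2 + b) * \<epsilon>)\<^sup>2"
        using M L'_norm[OF t01] by (intro mult_left_mono power_mono) auto
      finally have "?g (\<gamma> t) ?v ?v \<le> P * (M * ((2 + b) * \<epsilon>)\<^sup>2)"
        using P(1) unfolding product_metric_def P_def by (rule mult_left_mono)
      also have "\<dots> \<le> (C * s powr - (2 * a)) * (M * ((2 + b) * \<epsilon>)\<^sup>2)"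
        using P(2) M by (intro mult_right_mono) auto
      also have "s powr - (2 * a) = (s powr - a)\<^sup>2"
        by (simp add: power2_eq_square powr_add[symmetric])
      also have "(C * (s powr - a)\<^sup>2) * (M * ((2 + b) * \<epsilon>)\<^sup>2) = (C * M) * (s powr - a * ((2 + b) * \<epsilon>))\<^sup>2"
        by (simp add: power_mult_distrib)
      finally have "sqrt (?g (\<gamma> t) ?v ?v) \<le> sqrt ((C * M) * (s powr - a * ((2 + b) * \<epsilon>))\<^sup>2)"
        by (rule real_sqrt_le_mono)
      also have "\<dots> = sqrt (C * M) * (s powr - a * ((2 + b) * \<epsilon>))"
        using b \<epsilon>(1) by (simp add: real_sqrt_mult)
      \<comment> \<open>Here the bound separates into the Beta integrand and a power of \<epsilon>,
        which then merges with the \<epsilon> of the speed.\<close>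
      also have "s powr - a = \<epsilon> powr - a * (t powr - a * (1 - t) powr - a)"
        using t \<epsilon>(1) by (simp add: s_def powr_mult)
      also have "sqrt (C * M) * (\<epsilon> powr - a * (t powr - a * (1 - t) powr - a) * ((2 + b) * \<epsilon>)) =
          B * (\<epsilon> powr 1 * \<epsilon> powr - a) * (t powr - a * (1 - t) powr - a)"
        using \<epsilon>(1) by (simp add: B_def)
      also have "\<epsilon> powr 1 * \<epsilon> powr - a = \<epsilon> powr (1 - a)"
        unfolding powr_add[symmetric] by simp
      finally show "sqrt (?g (\<gamma> t) ?v ?v) \<le> B * \<epsilon> powr (1 - a) * (t powr - a * (1 - t) powr - a)" .
    qed
    also have "\<dots> < e'" using small by (simp add: ac_simps)
    finally have "ennreal (curve_length A ?g \<gamma>) < ennreal e'"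
      using e'(1) by (intro ennreal_lessI)
    moreover have "interior_distance A ?g q q' \<le> ennreal (curve_length A ?g \<gamma>)"
      unfolding interior_distance_def
      using curve(1,2) x(3) y(3) by (intro INF_lower) (simp add: \<gamma>_def L_def)
    ultimately show "interior_distance A ?g q q' < e" using e'(2) by order
  qed
qed

text \<open>Shifting the coordinates of \<open>p\<close> by shrinking multiples of (1,...,1) makes
  all corner coordinates positive. This supplies a representative for the point of the
  completion.\<close>

lemma mfd_interior_sequence:
  fixes A :: "('m::{t2_space, second_countable_topology}, 'n::finite) corner_chart set"
  assumes man: "manifold_with_corners A"
  obtains q where "range q \<subseteq> mfd_interior A" "q \<longlonglongrightarrow> p"
proof -
  obtain c where c: "c \<in> charts_at A p" using charts_at_nonempty[OF man] .
  note cA = charts_atD(1)[OF c] and pc = charts_atD(2)[OF c]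
  let ?x0 = "chart_map c p"
  obtain r where r: "0 < r" "\<And>x. dist x ?x0 < r \<Longrightarrow> x \<in> corner_model (chart_corner c) \<Longrightarrow>
      x \<in> chart_map c ` chart_dom c"
    using eventually_chart_image[OF man c open_UNIV UNIV_I] unfolding eventually_nhds_metric
    by (elim exE conjE) simp
  define \<delta> where "\<delta> = r / (2 * (1 + norm (vec 1 :: real ^ 'n)))"
  have \<delta>: "0 < \<delta>" using r(1) by (simp add: \<delta>_def add_pos_nonneg)
  define x where "x n = ?x0 + (\<delta> / real (Suc n)) *\<^sub>R vec 1" for n
  have pos: "0 < x n $ k" if "k \<in> chart_corner c" for n k
    using chart_map_corner[OF man cA pc that] \<delta> by (simp add: x_def add_nonneg_pos)
  have "dist (x n) ?x0 < r" for n
  proof -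
    have "dist (x n) ?x0 = \<delta> / real (Suc n) * norm (vec 1 :: real ^ 'n)"
      using \<delta> by (simp add: x_def dist_norm)
    also have "\<dots> \<le> \<delta> * norm (vec 1 :: real ^ 'n)"
      using \<delta> by (intro mult_right_mono) (simp_all add: divide_le_eq)
    also have "\<dots> < r" using r(1) by (simp add: \<delta>_def divide_simps add_pos_nonneg)
    finally show ?thesis .
  qed
  then have xU: "x n \<in> chart_map c ` chart_dom c" for n
    using r(2) pos by (auto simp: corner_model_def less_imp_le)
  define q where "q n = chart_inv c (x n)" for n
  show ?thesis
  proof (rule that)
    show "range q \<subseteq> mfd_interior A"
      using pos cA chart_inv_dom[OF man cA xU] chart_map_inv[OF man cA xU]
      by (auto simp: q_def charts_at_def intro!: coord_pos_imp_mfd_interior[OF man, of c])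
    have "(\<lambda>n. \<delta> * inverse (real (Suc n))) \<longlonglongrightarrow> \<delta> * 0"
      by (intro tendsto_intros LIMSEQ_inverse_real_of_nat)
    then have "(\<lambda>n. ?x0 + (\<delta> / real (Suc n)) *\<^sub>R vec 1) \<longlonglongrightarrow> ?x0 + 0 *\<^sub>R vec 1"
      unfolding divide_inverse mult_zero_right by (intro tendsto_intros)
    then have "x \<longlonglongrightarrow> ?x0" by (simp add: x_def[abs_def])
    then have "(\<lambda>n. chart_inv c (x n)) \<longlonglongrightarrow> chart_inv c ?x0"
      using pc xU by (intro continuous_on_tendsto_compose[OF chart_inv_continuous[OF man cA]]) auto
    then show "q \<longlonglongrightarrow> p" using chart_inv_map[OF man cA pc] by (simp add: q_def[abs_def])
  qed
qed

theorem theorem4p3: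
  fixes A :: "('m::{t2_space, second_countable_topology}, 'n::finite) corner_chart set"
    and H :: "nat \<Rightarrow> 'm set"
    and \<rho> :: "nat \<Rightarrow> 'm \<Rightarrow> real"
    and \<alpha> :: "nat \<Rightarrow> real"
    and g0 :: "('m, 'n) metric_tensor"
    and N :: nat and I :: "nat set" and p :: 'm
  assumes "manifold_with_corners A"
    and "compact (UNIV :: 'm set)"
    and "bij_betw H {1..N} (boundary_hypersurfaces A)"
    and "\<And>i. i \<in> {1..N} \<Longrightarrow> embedded_hypersurface A (H i)"
    and "\<And>i. i \<in> {1..N} \<Longrightarrow> boundary_defining_function A (H i) (\<rho> i)"
    and "riemannian_metric A g0"
    and "\<And>i. i \<in> {1..N} \<Longrightarrow> 0 \<le> \<alpha> i"
    and "I \<subseteq> {1..N}" and "I \<noteq> {}"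
    and "p \<in> open_face H N I"
    and "(\<Sum>i\<in>I. \<alpha> i) < 2"
  shows "let X0 = mfd_interior A; d = interior_distance A (product_metric \<rho> \<alpha> N g0) in
     (\<forall>q q'. range q \<subseteq> X0 \<and> range q' \<subseteq> X0 \<and> q \<longlonglongrightarrow> p \<and> q' \<longlonglongrightarrow> p \<longrightarrow>
        (\<lambda>n. d (q n) (q' n)) \<longlonglongrightarrow> 0) \<and>
     (\<exists>\<xi>\<in>metric_completion X0 d. \<forall>q. range q \<subseteq> X0 \<and> q \<longlonglongrightarrow> p \<longrightarrow> determines_point X0 d q \<xi>)"
proof -
  define X0 where "X0 = mfd_interior A"
  define d where "d = interior_distance A (product_metric \<rho> \<alpha> N g0)"
  note man = assms(1)
  obtain c where c: "c \<in> charts_at A p" using charts_at_nonempty[OF man] .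
  \<comment> \<open>Smallness for all pairs near \<open>p\<close> at once yields both the limit
    along two sequences and the Cauchy property of one.\<close>
  have near: "\<exists>W. open W \<and> p \<in> W \<and> (\<forall>x\<in>W \<inter> X0. \<forall>y\<in>W \<inter> X0. d x y < e)" if "0 < e" for e
    using nearby_points_short_distance[OF man c assms(4-7,10,11) that] unfolding X0_def d_def by metis
  have tri: "d x z \<le> d x y + d y z" for x y z
    unfolding d_def
    by (rule interior_distance_triangle[OF man]) (rule product_metric_scaleR[OF man assms(6)])
  define conv where "conv q \<longleftrightarrow> range q \<subseteq> X0 \<and> q \<longlonglongrightarrow> p" for q
  have in_nhd: "\<forall>\<^sub>F n in sequentially. q n \<in> W \<inter> X0" if "conv q" "open W" "p \<in> W" for q W
    using topological_tendstoD[of q p sequentially W] that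
    by (auto simp: conv_def elim!: eventually_mono)
  have lim0: "(\<lambda>n. d (q n) (q' n)) \<longlonglongrightarrow> 0" if "conv q" "conv q'" for q q'
  proof (rule order_tendstoI)
    fix e :: ennreal assume "0 < e"
    then obtain W where W: "open W" "p \<in> W" "\<forall>x\<in>W \<inter> X0. \<forall>y\<in>W \<inter> X0. d x y < e" using near by blast
    show "\<forall>\<^sub>F n in sequentially. d (q n) (q' n) < e"
      using in_nhd[OF that(1) W(1,2)] in_nhd[OF that(2) W(1,2)]
      by eventually_elim (use W(3) in blast)
  qed simp
  have cauchy: "q \<in> cauchy_seqs X0 d" if "conv q" for q
  proof -
    have "\<exists>M. \<forall>m\<ge>M. \<forall>n\<ge>M. d (q m) (q n) < e" if "0 < e" for e
    proof -
      obtain W where W: "open W" "p \<in> W" "\<forall>x\<in>W \<inter> X0. \<forall>y\<in>W \<inter> X0. d x y < e"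
        using near[OF \<open>0 < e\<close>] by blast
      then show ?thesis
        using in_nhd[OF \<open>conv q\<close> W(1,2)] unfolding eventually_sequentially by metis
    qed
    then show ?thesis using that by (auto simp: cauchy_seqs_def conv_def)
  qed
  \<comment> \<open>\<open>lim0\<close> holds in both orders, so exchanging \<open>q\<close> and
    \<open>q'\<close> turns the inclusion into equality of the classes.\<close>
  have sub: "cauchy_equiv X0 d `` {q} \<subseteq> cauchy_equiv X0 d `` {q'}" if "conv q" "conv q'" for q q'
  proof
    fix r assume "r \<in> cauchy_equiv X0 d `` {q}"
    then have r: "r \<in> cauchy_seqs X0 d" "(\<lambda>n. d (q n) (r n)) \<longlonglongrightarrow> 0"
      by (auto simp: cauchy_equiv_def)
    have lim: "(\<lambda>n. d (q' n) (q n) + d (q n) (r n)) \<longlonglongrightarrow> 0"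
      using tendsto_add[OF lim0[OF that(2,1)] r(2)] by simp
    have "(\<lambda>n. d (q' n) (r n)) \<longlonglongrightarrow> 0"
      by (rule tendsto_sandwich[OF _ _ tendsto_const lim]) (simp_all add: tri)
    then show "r \<in> cauchy_equiv X0 d `` {q'}" using r(1) cauchy[OF that(2)] by (simp add: cauchy_equiv_def)
  qed
  obtain q0 where q0: "conv q0" using mfd_interior_sequence[OF man, of p] by (auto simp: conv_def X0_def)
  have "cauchy_equiv X0 d `` {q0} \<in> metric_completion X0 d"
    unfolding metric_completion_def by (intro quotientI cauchy q0)
  moreover have "determines_point X0 d q (cauchy_equiv X0 d `` {q0})" if "conv q" for q
    using that q0 sub cauchy unfolding determines_point_def by blast
  ultimately show ?thesis
    using lim0 unfolding Let_def X0_def[symmetric] d_def[symmetric] conv_def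
    by (intro conjI allI impI bexI[of _ "cauchy_equiv X0 d `` {q0}"]) simp_all
qed

end
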